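(* Let $(\mathfrak{s},h)$ be a 6-dimensional nonunimodular solvable metric Lie algebra with $h$ Einstein. Then on $\mathfrak{s}$ there are no coupled $\mathrm{SU}(3)$-structures inducing the Einstein inner product $h$.
   Context: Stable forms. Let $V$ be a 6-dimensional real vector space. A 2-form $\omega$ on $V$ is stable if and only if $\omega^3\neq 0$. Let $A:\Lambda^5(V^* )\to V\otimes\Lambda^6(V^* )$ be the isomorphism $A(\gamma)=v\otimes\Omega$ where $i_v\Omega=\gamma$. For $\rho\in\Lambda^3(V^* )$ put $K_\rho:V\to V\otimes\Lambda^6(V^* )$, $K_\rho(v)=A((i_v\rho)\wedge\rho)$, and $\lambda(\rho)=\frac16\mathrm{tr}K_\rho^2\in(\Lambda^6(V^* ))^{\otimes 2}$. A 3-form $\rho$ is stable if and only if $\lambda(\rho)\neq 0$. Orient $V$ so that $\omega^3$ is positive, and let $\sqrt{|\lambda(\rho)|}\in\Lambda^6(V^* )$ be the corresponding positive volume form; then $J_\rho=-\frac{1}{\sqrt{|\lambda(\rho)|}}K_\rho$ is an almost complex structure when $\lambda(\rho)<0$. $\mathrm{SU}(3)$-structures. An $\mathrm{SU}(3)$-structure on a 6-dimensional real Lie algebra $\mathfrak{s}$ is a pair $(\omega,\psi_+)\in\Lambda^2(\mathfrak{s}^* )\times\Lambda^3(\mathfrak{s}^* )$ of stable forms with $\lambda(\psi_+)<0$, which are compatible ($\omega\wedge\psi_+=0$), satisfy the normalization condition $\psi_+\wedge\psi_-=\frac23\omega^3$, where $J=J_{\psi_+}$ and $\psi_-=J^*\psi_+$,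 and are such that $\omega(\cdot,J\cdot)$ is an inner product; this is the inner product induced by $(\omega,\psi_+)$. With $d$ the Chevalley-Eilenberg differential of $\mathfrak{s}$, the structure is half-flat if $d\psi_+=0$ and $d(\omega\wedge\omega)=0$; a half-flat structure is coupled if $d\omega=c\,\psi_+$ for some $c\in\mathbb{R}\setminus\{0\}$. A solvable metric Lie algebra $(\mathfrak{s},h)$ is a real solvable Lie algebra $\mathfrak{s}$ with an inner product $h$; $h$ is identified with a left invariant Riemannian metric on the simply connected Lie group with Lie algebra $\mathfrak{s}$, and $h$ is called Einstein if this metric satisfies $\mathrm{Ric}(h)=\mu h$ for some real number $\mu$. *)

theory Defs
  imports "HOL-Analysis.Analysis" "HOL-Combinatorics.Permutations"
begin

text \<open>The trace of an endomorphism, computed in one (arbitrary) basis of the whole space.\<close>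

definition endo_trace :: "('a::real_vector \<Rightarrow> 'a) \<Rightarrow> real" where
  "endo_trace f = (let B = real_vector.extend_basis {} in
     \<Sum>b\<in>B. real_vector.representation B (f b) b)"

definition is_inner_product :: "('a::real_vector \<Rightarrow> 'a \<Rightarrow> real) \<Rightarrow> bool" where
  "is_inner_product h \<longleftrightarrow>
     bilinear h \<and> (\<forall>x y. h x y = h y x) \<and> (\<forall>x. x \<noteq> 0 \<longrightarrow> h x x > 0)"

text \<open>A $k$-form is represented by a function on argument lists, which is $0$ on lists whose
  length is not $k$; so two $k$-forms are equal iff they are equal as functions.\<close>

definition alt_form :: "nat \<Rightarrow> ('a::real_vector list \<Rightarrow> real) \<Rightarrow> bool" where
  "alt_form k \<alpha> \<longleftrightarrow>
     (\<forall>xs. length xs \<noteq> k \<longrightarrow> \<alpha> xs = 0) \<and>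
     (\<forall>xs i. length xs = k \<and> i < k \<longrightarrow> linear (\<lambda>v. \<alpha> (xs[i := v]))) \<and>
     (\<forall>xs i j. length xs = k \<and> i < j \<and> j < k \<and> xs ! i = xs ! j \<longrightarrow> \<alpha> xs = 0)"

text \<open>The exterior product of a $k$-form and an $l$-form, with the normalisation
  $(e^1 \wedge \dots \wedge e^n)(e_1, \dots, e_n) = 1$.\<close>

definition wedge :: "nat \<Rightarrow> nat \<Rightarrow> ('a list \<Rightarrow> real) \<Rightarrow> ('a list \<Rightarrow> real) \<Rightarrow> 'a list \<Rightarrow> real" where
  "wedge k l \<alpha> \<beta> xs =
     (if length xs = k + l
      then (\<Sum>p | p permutes {..<k + l}.
              of_int (sign p) * \<alpha> (map (\<lambda>i. xs ! p i) [0..<k])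
                              * \<beta> (map (\<lambda>i. xs ! p i) [k..<k + l])) / (fact k * fact l)
      else 0)"

definition contract :: "'a \<Rightarrow> ('a list \<Rightarrow> real) \<Rightarrow> 'a list \<Rightarrow> real" where
  "contract v \<alpha> xs = \<alpha> (v # xs)"

definition pullback :: "('a \<Rightarrow> 'a) \<Rightarrow> ('a list \<Rightarrow> real) \<Rightarrow> 'a list \<Rightarrow> real" where
  "pullback f \<alpha> xs = \<alpha> (map f xs)"

definition cube :: "('a list \<Rightarrow> real) \<Rightarrow> 'a list \<Rightarrow> real" where
  "cube \<omega> = wedge 4 2 (wedge 2 2 \<omega> \<omega>) \<omega>"

definition stable2 :: "('a list \<Rightarrow> real) \<Rightarrow> bool" where
  "stable2 \<omega> \<longleftrightarrow> cube \<omega> \<noteq> (\<lambda>_. 0)"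

text \<open>An element of $V \otimes \Lambda^6 V^*$ is represented by the $V$-valued 6-form it defines,
  $v \otimes \Omega$ being the map sending \<open>xs\<close> to \<open>\<Omega> xs *\<^sub>R v\<close>; every element has this shape, since
  $\Lambda^6 V^*$ is a line. The map below is the isomorphism
  $A : \Lambda^5 V^* \to V \otimes \Lambda^6 V^*$.\<close>

definition A_iso :: "('a::real_vector list \<Rightarrow> real) \<Rightarrow> 'a list \<Rightarrow> 'a" where
  "A_iso \<gamma> = (THE T. \<exists>v \<Omega>. alt_form 6 \<Omega> \<and> contract v \<Omega> = \<gamma> \<and> T = (\<lambda>xs. \<Omega> xs *\<^sub>R v))"

definition K_map :: "('a::real_vector list \<Rightarrow> real) \<Rightarrow> 'a \<Rightarrow> 'a list \<Rightarrow> 'a" where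
  "K_map \<rho> v = A_iso (wedge 2 3 (contract v \<rho>) \<rho>)"

text \<open>$\lambda(\rho) \in (\Lambda^6 V^*)^{\otimes 2}$, as a function of two argument lists:
  $\Omega_1 \otimes \Omega_2$ is represented by \<open>\<lambda>xs ys. \<Omega>\<^sub>1 xs * \<Omega>\<^sub>2 ys\<close>.\<close>

definition lam :: "('a::real_vector list \<Rightarrow> real) \<Rightarrow> 'a list \<Rightarrow> 'a list \<Rightarrow> real" where
  "lam \<rho> xs ys = endo_trace (\<lambda>v. K_map \<rho> (K_map \<rho> v xs) ys) / 6"

definition stable3 :: "('a::real_vector list \<Rightarrow> real) \<Rightarrow> bool" where
  "stable3 \<rho> \<longleftrightarrow> lam \<rho> \<noteq> (\<lambda>_ _. 0)"

text \<open>An element $s\,\Omega \otimes \Omega$ of the line $(\Lambda^6 V^*)^{\otimes 2}$, where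
  $\Omega \neq 0$, is negative iff $s < 0$, that is, iff it takes a negative value somewhere on the
  diagonal.\<close>

definition lam_negative :: "('a::real_vector list \<Rightarrow> real) \<Rightarrow> bool" where
  "lam_negative \<rho> \<longleftrightarrow> (\<exists>xs. lam \<rho> xs xs < 0)"

text \<open>$\sqrt{|\lambda(\rho)|}$: the 6-form whose square is $|\lambda(\rho)|$ and which is positive for
  the orientation given by $\omega^3$.\<close>

definition sqrt_lam :: "('a::real_vector list \<Rightarrow> real) \<Rightarrow> ('a list \<Rightarrow> real) \<Rightarrow> 'a list \<Rightarrow> real" where
  "sqrt_lam \<omega> \<rho> xs = sgn (cube \<omega> xs) * sqrt \<bar>lam \<rho> xs xs\<bar>"

text \<open>$J_\rho = -K_\rho / \sqrt{|\lambda(\rho)|}$: the vector $J_\rho v$ is determined by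
  $K_\rho(v) = -\,J_\rho v \otimes \sqrt{|\lambda(\rho)|}$.\<close>

definition J_map :: "('a::real_vector list \<Rightarrow> real) \<Rightarrow> ('a list \<Rightarrow> real) \<Rightarrow> 'a \<Rightarrow> 'a" where
  "J_map \<omega> \<rho> v = (THE w. K_map \<rho> v = (\<lambda>xs. - (sqrt_lam \<omega> \<rho> xs *\<^sub>R w)))"

definition psi_minus :: "('a::real_vector list \<Rightarrow> real) \<Rightarrow> ('a list \<Rightarrow> real) \<Rightarrow> 'a list \<Rightarrow> real" where
  "psi_minus \<omega> \<psi> = pullback (J_map \<omega> \<psi>) \<psi>"

definition induced_metric :: "('a::real_vector list \<Rightarrow> real) \<Rightarrow> ('a list \<Rightarrow> real) \<Rightarrow> 'a \<Rightarrow> 'a \<Rightarrow> real" where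
  "induced_metric \<omega> \<psi> x y = \<omega> [x, J_map \<omega> \<psi> y]"

definition SU3_structure :: "('a::real_vector list \<Rightarrow> real) \<Rightarrow> ('a list \<Rightarrow> real) \<Rightarrow> bool" where
  "SU3_structure \<omega> \<psi> \<longleftrightarrow>
     alt_form 2 \<omega> \<and> alt_form 3 \<psi> \<and> stable2 \<omega> \<and> stable3 \<psi> \<and> lam_negative \<psi> \<and>
     wedge 2 3 \<omega> \<psi> = (\<lambda>_. 0) \<and>
     wedge 3 3 \<psi> (psi_minus \<omega> \<psi>) = (\<lambda>xs. 2 / 3 * cube \<omega> xs) \<and>
     is_inner_product (induced_metric \<omega> \<psi>)"

definition lie_bracket :: "('a::real_vector \<Rightarrow> 'a \<Rightarrow> 'a) \<Rightarrow> bool" where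
  "lie_bracket br \<longleftrightarrow>
     bilinear br \<and> (\<forall>x. br x x = 0) \<and>
     (\<forall>x y z. br x (br y z) + br y (br z x) + br z (br x y) = 0)"

primrec derived_series :: "('a::real_vector \<Rightarrow> 'a \<Rightarrow> 'a) \<Rightarrow> nat \<Rightarrow> 'a set" where
  "derived_series br 0 = UNIV"
| "derived_series br (Suc n) =
     span {br x y | x y. x \<in> derived_series br n \<and> y \<in> derived_series br n}"

definition solvable :: "('a::real_vector \<Rightarrow> 'a \<Rightarrow> 'a) \<Rightarrow> bool" where
  "solvable br \<longleftrightarrow> (\<exists>n. derived_series br n = {0})"

definition unimodular :: "('a::real_vector \<Rightarrow> 'a \<Rightarrow> 'a) \<Rightarrow> bool" where
  "unimodular br \<longleftrightarrow> (\<forall>x. endo_trace (br x) = 0)"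

text \<open>The Chevalley-Eilenberg differential
  \[ d\alpha(x_0, \dots, x_k) = \sum_{i<j} (-1)^{i+j}
       \alpha([x_i, x_j], x_0, \dots, \hat{x}_i, \dots, \hat{x}_j, \dots, x_k). \]\<close>

definition ce_d :: "('a \<Rightarrow> 'a \<Rightarrow> 'a) \<Rightarrow> ('a list \<Rightarrow> real) \<Rightarrow> 'a list \<Rightarrow> real" where
  "ce_d br \<alpha> xs =
     (\<Sum>j<length xs. \<Sum>i<j. (-1) ^ (i + j) * \<alpha> (br (xs ! i) (xs ! j) # nths xs (- {i, j})))"

definition half_flat :: "('a::real_vector \<Rightarrow> 'a \<Rightarrow> 'a) \<Rightarrow> ('a list \<Rightarrow> real) \<Rightarrow> ('a list \<Rightarrow> real) \<Rightarrow> bool" where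
  "half_flat br \<omega> \<psi> \<longleftrightarrow>
     SU3_structure \<omega> \<psi> \<and> ce_d br \<psi> = (\<lambda>_. 0) \<and> ce_d br (wedge 2 2 \<omega> \<omega>) = (\<lambda>_. 0)"

definition coupled :: "('a::real_vector \<Rightarrow> 'a \<Rightarrow> 'a) \<Rightarrow> ('a list \<Rightarrow> real) \<Rightarrow> ('a list \<Rightarrow> real) \<Rightarrow> bool" where
  "coupled br \<omega> \<psi> \<longleftrightarrow>
     half_flat br \<omega> \<psi> \<and> (\<exists>c. c \<noteq> 0 \<and> ce_d br \<omega> = (\<lambda>xs. c * \<psi> xs))"

text \<open>Geometry of the left invariant metric defined by \<open>h\<close>, restricted to left invariant vector
  fields, on which \<open>h\<close> is constant: the Levi-Civita connection is the unique torsion-free metric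
  product on the Lie algebra.\<close>

definition levi_civita ::
  "('a::real_vector \<Rightarrow> 'a \<Rightarrow> 'a) \<Rightarrow> ('a \<Rightarrow> 'a \<Rightarrow> real) \<Rightarrow> 'a \<Rightarrow> 'a \<Rightarrow> 'a" where
  "levi_civita br h = (THE D. bilinear D \<and>
     (\<forall>x y. D x y - D y x = br x y) \<and>
     (\<forall>x y z. h (D x y) z + h y (D x z) = 0))"

definition curvature ::
  "('a::real_vector \<Rightarrow> 'a \<Rightarrow> 'a) \<Rightarrow> ('a \<Rightarrow> 'a \<Rightarrow> real) \<Rightarrow> 'a \<Rightarrow> 'a \<Rightarrow> 'a \<Rightarrow> 'a" where
  "curvature br h x y z =
     (let D = levi_civita br h in D x (D y z) - D y (D x z) - D (br x y) z)"

definition Ric ::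
  "('a::real_vector \<Rightarrow> 'a \<Rightarrow> 'a) \<Rightarrow> ('a \<Rightarrow> 'a \<Rightarrow> real) \<Rightarrow> 'a \<Rightarrow> 'a \<Rightarrow> real" where
  "Ric br h y z = endo_trace (\<lambda>x. curvature br h x y z)"

definition Einstein :: "('a::real_vector \<Rightarrow> 'a \<Rightarrow> 'a) \<Rightarrow> ('a \<Rightarrow> 'a \<Rightarrow> real) \<Rightarrow> bool" where
  "Einstein br h \<longleftrightarrow> (\<exists>\<mu>. \<forall>y z. Ric br h y z = \<mu> * h y z)"

end

theory Submission
  imports Defs
begin

text \<open>The sign of the Einstein constant decides. Write $\mathrm{Ric}(h) = \mu h$.

  A nonunimodular Lie algebra forces $\mu < 0$: the Ricci curvature in the direction of the mean
  curvature vector $H$, given by $h(H, x) = \mathrm{tr}(\mathrm{ad}\, x)$, equals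
  $-|\nabla H|^2 < 0$ (\<open>einstein_nonunimodular_negative\<close>).

  A coupled structure forces $\mu \ge 0$ (\<open>coupled_einstein_nonneg\<close>). First,
  $J = J_\psi$ is an orthogonal complex structure for the induced metric and $\psi$ has type
  $(3,0) + (0,3)$ (\<open>SU3_structure_complex\<close>). Let $\phi$ be the normalised multiple of
  $\psi$ and $\nabla$ the Levi-Civita connection. The covariant derivative of $J$ is encoded by an
  endomorphism $T$ with $h((\nabla_x J) y, z) = \phi(T x, y, z)$. The equation
  $d\omega = c \, \psi$ makes $T$ commute with $J$ (\<open>torsion_commutes\<close>), and
  $d\psi = 0$ makes $T$ symmetric and leaves $\nabla$ without a component along $J$
  (\<open>T_symmetric\<close>, \<open>trJ_eq_0\<close>). Hence $T$ is diagonal, with real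
  eigenvalues $s_1, s_2, s_3$, in a unitary frame adapted to $\phi$.

  The part of the Ricci tensor that is invariant under $J$ is then an algebraic function of $T$. It
  is obtained from the trace of $J R(x, y)$ and from the commutator of $R$ with $J$ by means of
  the Bianchi identity; for an Einstein metric the outcome is
  $\mu = s_1^2 + s_1 s_2 + s_1 s_3 + 2 s_2 s_3$ together with its cyclic permutations
  (\<open>einstein_constant\<close>). Subtracting these equations shows that two eigenvalues agree
  and that the third one equals them or vanishes, so that $\mu$ is $5 s^2$ or $2 s^2$.\<close>

section \<open>Alternating forms\<close>

lemma alt_form_length: "alt_form k \<alpha> \<Longrightarrow> length xs \<noteq> k \<Longrightarrow> \<alpha> xs = 0"
  by (simp add: alt_form_def)

lemma alt_form_linear:
  "alt_form k \<alpha> \<Longrightarrow> length xs = k \<Longrightarrow> i < k \<Longrightarrow> linear (\<lambda>v. \<alpha> (xs[i := v]))"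
  by (simp add: alt_form_def)

lemma alt_form_repeat:
  assumes "alt_form k \<alpha>" "\<not> distinct xs" shows "\<alpha> xs = 0"
proof (cases "length xs = k")
  case True
  obtain i j where "i < length xs" "j < length xs" "i \<noteq> j" "xs ! i = xs ! j"
    using assms(2) unfolding distinct_conv_nth by blast
  then show ?thesis using assms(1) True unfolding alt_form_def
    by (metis linorder_neqE_nat)
qed (use assms alt_form_length in blast)

text \<open>Polarise: the form vanishes when the vectors at places $i$ and $j$ are both replaced by the sum of
  the two.\<close>

lemma alt_form_swap:
  assumes "alt_form k \<alpha>" "length xs = k" "i < k" "j < k" "i \<noteq> j"
  shows "\<alpha> (xs[i := xs ! j, j := xs ! i]) = - \<alpha> xs"
proof -
  let ?F = "\<lambda>u v. \<alpha> (xs[i := u, j := v])"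
  have lin1: "linear (\<lambda>u. ?F u v)" for v
    using alt_form_linear[OF assms(1), of "xs[j := v]" i] assms by (simp add: list_update_swap)
  have lin2: "linear (?F u)" for u
    using alt_form_linear[OF assms(1), of "xs[i := u]" j] assms by simp
  have diag: "?F u u = 0" for u
  proof (rule alt_form_repeat[OF assms(1)])
    have "xs[i := u, j := u] ! i = xs[i := u, j := u] ! j" using assms by simp
    then show "\<not> distinct (xs[i := u, j := u])"
      using assms unfolding distinct_conv_nth by (metis length_list_update)
  qed
  have "?F (xs ! i + xs ! j) (xs ! i + xs ! j) = ?F (xs ! i) (xs ! i) + ?F (xs ! i) (xs ! j)
      + (?F (xs ! j) (xs ! i) + ?F (xs ! j) (xs ! j))"
    by (simp add: linear_add[OF lin1] linear_add[OF lin2])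
  then have "?F (xs ! i) (xs ! j) + ?F (xs ! j) (xs ! i) = 0"
    unfolding diag by linarith
  then show ?thesis by simp
qed

lemma alt_form_permute:
  assumes "alt_form k \<alpha>" "length xs = k" "p permutes {..<k}"
  shows "\<alpha> (permute_list p xs) = of_int (sign p) * \<alpha> xs"
  using finite_lessThan assms(3)
proof (induction rule: permutes_rev_induct)
  case id
  then show ?case by simp
next
  case (swap a b p)
  let ?t = "Transposition.transpose a b"
  have ab: "a < k" "b < k" "a \<noteq> b" using swap by auto
  have t: "?t permutes {..<k}" using ab by (intro permutes_swap_id) auto
  have "permute_list (p \<circ> ?t) xs = permute_list ?t (permute_list p xs)"
    using t assms by (intro permute_list_compose) simp
  also have "\<dots> = (permute_list p xs)[a := permute_list p xs ! b, b := permute_list p xs ! a]"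
    using ab assms t by (intro nth_equalityI)
      (auto simp: permute_list_nth nth_list_update Transposition.transpose_def)
  also have "\<alpha> \<dots> = - \<alpha> (permute_list p xs)"
    using assms ab by (intro alt_form_swap[of k]) auto
  also have "\<dots> = - of_int (sign p) * \<alpha> xs" using swap by simp
  also have "- of_int (sign p) = (of_int (sign (p \<circ> ?t)) :: real)"
    using ab swap permutes_imp_permutation[OF finite_lessThan]
    by (simp add: sign_compose permutation_swap_id sign_swap_id)
  finally show ?case .
qed

text \<open>Rearranging the arguments only changes the sign. So when the vanishing of a form is at stake, the
  order of a list of basis vectors is irrelevant.\<close>

lemma alt_form_mset:
  assumes "alt_form k \<alpha>" "mset xs = mset ys" "\<alpha> ys = 0"
  shows "\<alpha> xs = 0"
proof (cases "length ys = k")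
  case True
  obtain p where "p permutes {..<length ys}" "permute_list p ys = xs"
    using mset_eq_permutation[OF assms(2)] .
  then show ?thesis using alt_form_permute[OF assms(1) True] True assms(3) by auto
next
  case False
  then show ?thesis using assms mset_eq_length alt_form_length by metis
qed

lemma linear_real_mult: "linear f \<Longrightarrow> linear (\<lambda>x. c * f x)" for f :: "'a::real_vector \<Rightarrow> real"
  using linear_compose_scale_right[of f c] by simp

lemma alt_form_diff:
  assumes "alt_form k \<alpha>" "alt_form k \<beta>"
  shows "alt_form k (\<lambda>xs. a * \<alpha> xs - b * \<beta> xs)"
  using assms unfolding alt_form_def
  by (auto intro!: linear_compose_sub linear_real_mult)

lemma alt_form_contract:
  assumes "alt_form (Suc k) \<alpha>"
  shows "alt_form k (contract v \<alpha>)"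
  unfolding alt_form_def contract_def
proof (intro conjI allI impI)
  fix xs :: "'a list" assume "length xs \<noteq> k"
  then show "\<alpha> (v # xs) = 0" using assms by (simp add: alt_form_def)
next
  fix xs :: "'a list" and i assume "length xs = k \<and> i < k"
  then show "linear (\<lambda>w. \<alpha> (v # xs[i := w]))"
    using alt_form_linear[OF assms, of "v # xs" "Suc i"] by simp
next
  fix xs :: "'a list" and i j assume "length xs = k \<and> i < j \<and> j < k \<and> xs ! i = xs ! j"
  then have "\<not> distinct xs" unfolding distinct_conv_nth by (metis nat_neq_iff order.strict_trans)
  then show "\<alpha> (v # xs) = 0" by (intro alt_form_repeat[OF assms]) simp
qed

text \<open>Expand the first \<open>m\<close> arguments in the spanning set one after the other, by induction
  on \<open>m\<close>; lists with a repeated entry contribute nothing.\<close>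

lemma alt_form_eq_0I:
  fixes B :: "'a::real_vector set"
  assumes alt: "alt_form k \<alpha>" and B: "span B = UNIV"
    and 0: "\<And>xs. length xs = k \<Longrightarrow> set xs \<subseteq> B \<Longrightarrow> distinct xs \<Longrightarrow> \<alpha> xs = 0"
  shows "\<alpha> xs = 0"
proof -
  have "\<alpha> xs = 0" if "length xs = k" "m \<le> k" "\<And>i. m \<le> i \<Longrightarrow> i < k \<Longrightarrow> xs ! i \<in> B" for m xs
    using that
  proof (induction m arbitrary: xs)
    case 0
    have "set xs \<subseteq> B" using 0 by (auto simp: in_set_conv_nth)
    then show ?case using assms(3) alt_form_repeat[OF alt] 0 by blast
  next
    case (Suc m)
    have lin: "linear (\<lambda>v. \<alpha> (xs[m := v]))" using Suc alt_form_linear[OF alt] by simp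
    have "xs ! m \<in> span B" using B by simp
    then have "\<alpha> (xs[m := xs ! m]) = 0"
    proof (induction rule: span_induct_alt)
      case base
      then show ?case using linear_0[OF lin] .
    next
      case (step c x y)
      have "\<alpha> (xs[m := x]) = 0"
      proof (rule Suc.IH)
        fix i assume "m \<le> i" "i < k"
        then show "xs[m := x] ! i \<in> B" using Suc.prems step by (cases "i = m") auto
      qed (use Suc in auto)
      then show ?case using step linear_add[OF lin] linear_scale[OF lin] by simp
    qed
    then show ?case by simp
  qed
  from this[of xs k] show ?thesis using alt_form_length[OF alt] by (cases "length xs = k") auto
qed

section \<open>Exterior products\<close>

text \<open>A permutation $p$ puts the argument number $i$ into exactly one slot of one factor, which gives
  linearity. If the arguments $i$ and $j$ agree, composing $p$ with the transposition of $i$ and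
  $j$ flips the sign of a summand and changes nothing else, so the sum equals its own negative.\<close>

lemma alt_form_wedge:
  fixes \<alpha> \<beta> :: "'a::real_vector list \<Rightarrow> real"
  assumes \<alpha>: "alt_form k \<alpha>" and \<beta>: "alt_form l \<beta>"
  shows "alt_form (k + l) (wedge k l \<alpha> \<beta>)"
proof -
  define summand where "summand p xs = of_int (sign p) * \<alpha> (map (\<lambda>i. xs ! p i) [0..<k])
      * \<beta> (map (\<lambda>i. xs ! p i) [k..<k + l])" for p and xs :: "'a list"
  have w: "wedge k l \<alpha> \<beta> xs = (\<Sum>p | p permutes {..<k + l}. summand p xs) / (fact k * fact l)"
    if "length xs = k + l" for xs
    using that by (simp add: wedge_def summand_def)
  have lin: "linear (\<lambda>v. summand p (xs[i := v]))"
    if p: "p permutes {..<k + l}" and len: "length xs = k + l" and i: "i < k + l" for p xs i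
  proof -
    obtain j where j: "j < k + l" "p j = i"
      using p i by (metis lessThan_iff permutes_in_image permutes_surj surjD)
    have upd: "xs[i := v] ! p t = (if t = j then v else xs ! p t)" if "t < k + l" for v t
    proof -
      have "p t < length xs" using permutes_in_image[OF p] that len by auto
      moreover have "p t = i \<longleftrightarrow> t = j" using j permutes_inj[OF p] by (metis injD)
      ultimately show ?thesis by (auto simp: nth_list_update)
    qed
    show ?thesis
    proof (cases "j < k")
      case True
      have "map (\<lambda>t. xs[i := v] ! p t) [0..<k] = (map (\<lambda>t. xs ! p t) [0..<k])[j := v]" for v
        by (rule nth_equalityI) (auto simp: upd nth_list_update)
      moreover have "map (\<lambda>t. xs[i := v] ! p t) [k..<k + l] = map (\<lambda>t. xs ! p t) [k..<k + l]" for v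
        using True by (auto simp: upd)
      moreover have "linear (\<lambda>v. \<alpha> ((map (\<lambda>t. xs ! p t) [0..<k])[j := v]))"
        using alt_form_linear[OF \<alpha>] True by simp
      ultimately show ?thesis unfolding summand_def
        by (simp only:) (auto intro!: linear_real_mult simp: mult.commute[of _ "\<beta> _"])
    next
      case False
      have "map (\<lambda>t. xs[i := v] ! p t) [k..<k + l] = (map (\<lambda>t. xs ! p t) [k..<k + l])[j - k := v]" for v
      proof (rule nth_equalityI)
        fix m assume "m < length (map (\<lambda>t. xs[i := v] ! p t) [k..<k + l])"
        moreover have "k + m = j \<longleftrightarrow> m = j - k" using False by auto
        ultimately show "map (\<lambda>t. xs[i := v] ! p t) [k..<k + l] ! m
            = (map (\<lambda>t. xs ! p t) [k..<k + l])[j - k := v] ! m"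
          by (simp add: upd nth_list_update)
      qed simp
      moreover have "map (\<lambda>t. xs[i := v] ! p t) [0..<k] = map (\<lambda>t. xs ! p t) [0..<k]" for v
        using False by (auto simp: upd)
      moreover have "linear (\<lambda>v. \<beta> ((map (\<lambda>t. xs ! p t) [k..<k + l])[j - k := v]))"
        using alt_form_linear[OF \<beta>] False j by simp
      ultimately show ?thesis unfolding summand_def
        by (simp only:) (auto intro!: linear_real_mult)
    qed
  qed
  show ?thesis
    unfolding alt_form_def
  proof (intro conjI allI impI)
    fix xs :: "'a list" assume "length xs \<noteq> k + l"
    then show "wedge k l \<alpha> \<beta> xs = 0" by (simp add: wedge_def)
  next
    fix xs :: "'a list" and i assume *: "length xs = k + l \<and> i < k + l"
    have "linear (\<lambda>v. \<Sum>p | p permutes {..<k + l}. summand p (xs[i := v]))"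
      using * lin by (intro linear_compose_sum) auto
    then have "linear (\<lambda>v. 1 / (fact k * fact l) * (\<Sum>p | p permutes {..<k + l}. summand p (xs[i := v])))"
      by (rule linear_real_mult)
    then show "linear (\<lambda>v. wedge k l \<alpha> \<beta> (xs[i := v]))" using * by (simp add: w)
  next
    fix xs :: "'a list" and i j
    assume *: "length xs = k + l \<and> i < j \<and> j < k + l \<and> xs ! i = xs ! j"
    let ?t = "Transposition.transpose i j"
    have t: "?t permutes {..<k + l}" using * by (intro permutes_swap_id) auto
    have "summand (?t \<circ> p) xs = - summand p xs" if p: "p permutes {..<k + l}" for p
    proof -
      have "xs ! ?t m = xs ! m" for m using * by (simp add: Transposition.transpose_def)
      moreover have "sign (?t \<circ> p) = - sign p"
        using * permutes_imp_permutation[OF finite_lessThan p]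
        by (simp add: sign_compose permutation_swap_id sign_swap_id)
      ultimately show ?thesis by (simp add: summand_def)
    qed
    then have "(\<Sum>p | p permutes {..<k + l}. summand p xs) = - (\<Sum>p | p permutes {..<k + l}. summand p xs)"
      by (subst setum_permutations_compose_left[OF t]) (simp add: sum_negf)
    then show "wedge k l \<alpha> \<beta> xs = 0" using * by (simp add: w)
  qed
qed

text \<open>The unnormalised exterior product is a sum of this kind. The recursion below sums over the slot
  that receives the last argument; iterating it turns a sum over all permutations of a concrete
  finite set into explicit terms.\<close>

definition signed_sum :: "nat \<Rightarrow> ((nat \<Rightarrow> nat) \<Rightarrow> real) \<Rightarrow> real" where
  "signed_sum n g = (\<Sum>p | p permutes {..<n}. of_int (sign p) * g p)"

lemma signed_sum_Suc:
  "signed_sum (Suc n) g =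
     signed_sum n g - (\<Sum>b<n. signed_sum n (\<lambda>q. g (q \<circ> Transposition.transpose n b)))"
proof -
  let ?t = "Transposition.transpose n"
  have "signed_sum (Suc n) g = (\<Sum>p | p permutes {..<Suc n}. of_int (sign (inv p)) * g (inv p))"
    unfolding signed_sum_def by (rule sum_permutations_inverse)
  also have "\<dots> = (\<Sum>b\<in>insert n {..<n}. \<Sum>q | q permutes {..<n}.
      of_int (sign (inv (?t b \<circ> q))) * g (inv (?t b \<circ> q)))"
    unfolding lessThan_Suc by (rule sum_over_permutations_insert) auto
  also have "\<dots> = (\<Sum>b\<in>insert n {..<n}. (if b = n then 1 else -1) *
      (\<Sum>q | q permutes {..<n}. of_int (sign (inv q)) * g (inv q \<circ> ?t b)))"
    unfolding sum_distrib_left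
    by (intro sum.cong refl)
      (auto simp: sign_compose permutation_swap_id sign_swap_id sign_inverse o_inv_distrib permutes_bij
        permutation_compose permutation_inverse permutes_imp_permutation[OF finite_lessThan])
  also have "\<dots> = (\<Sum>b\<in>insert n {..<n}. (if b = n then 1 else -1) *
      signed_sum n (\<lambda>q. g (q \<circ> ?t b)))"
    unfolding signed_sum_def by (subst (2) sum_permutations_inverse) (rule refl)
  also have "\<dots> = signed_sum n g + (\<Sum>b<n. - signed_sum n (\<lambda>q. g (q \<circ> ?t b)))"
    by (simp add: sum_negf)
  finally show ?thesis by (simp add: sum_negf)
qed

lemma signed_sum_0: "signed_sum 0 g = g id"
  by (simp add: signed_sum_def)

lemma signed_sum_5:
  "signed_sum 5 g = signed_sum 4 g - signed_sum 4 (\<lambda>q. g (q \<circ> Transposition.transpose 4 0))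
    - signed_sum 4 (\<lambda>q. g (q \<circ> Transposition.transpose 4 1))
    - signed_sum 4 (\<lambda>q. g (q \<circ> Transposition.transpose 4 2))
    - signed_sum 4 (\<lambda>q. g (q \<circ> Transposition.transpose 4 3))"
  using signed_sum_Suc[of 4 g] by (simp add: eval_nat_numeral)

lemma signed_sum_4:
  "signed_sum 4 g = signed_sum 3 g - signed_sum 3 (\<lambda>q. g (q \<circ> Transposition.transpose 3 0))
    - signed_sum 3 (\<lambda>q. g (q \<circ> Transposition.transpose 3 1))
    - signed_sum 3 (\<lambda>q. g (q \<circ> Transposition.transpose 3 2))"
  using signed_sum_Suc[of 3 g] by (simp add: eval_nat_numeral)

lemma signed_sum_3:
  "signed_sum 3 g = g id - g (Transposition.transpose 1 0)
    - g (Transposition.transpose 2 0) + g (Transposition.transpose 1 0 \<circ> Transposition.transpose 2 0)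
    - g (Transposition.transpose 2 1) + g (Transposition.transpose 1 0 \<circ> Transposition.transpose 2 1)"
  using signed_sum_Suc[of 2 g] by (simp add: eval_nat_numeral signed_sum_Suc signed_sum_0)

lemma alt2_swap: "alt_form 2 \<alpha> \<Longrightarrow> \<alpha> [y, x] = - \<alpha> [x, y]"
  using alt_form_swap[of 2 \<alpha> "[x,y]" 0 1] by simp

lemma alt3_swaps:
  assumes "alt_form 3 \<beta>"
  shows "\<beta> [y, x, z] = - \<beta> [x, y, z]" "\<beta> [x, z, y] = - \<beta> [x, y, z]" "\<beta> [z, y, x] = - \<beta> [x, y, z]"
    "\<beta> [y, z, x] = \<beta> [x, y, z]" "\<beta> [z, x, y] = \<beta> [x, y, z]"
proof -
  have 1: "\<beta> [y, x, z] = - \<beta> [x, y, z]" for x y z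
    using alt_form_swap[OF assms, of "[x,y,z]" 0 1] by simp
  have 2: "\<beta> [x, z, y] = - \<beta> [x, y, z]" for x y z
    using alt_form_swap[OF assms, of "[x,y,z]" 1 2] by simp
  show "\<beta> [y, x, z] = - \<beta> [x, y, z]" "\<beta> [x, z, y] = - \<beta> [x, y, z]" "\<beta> [z, y, x] = - \<beta> [x, y, z]"
    "\<beta> [y, z, x] = \<beta> [x, y, z]" "\<beta> [z, x, y] = \<beta> [x, y, z]"
    using 1 2 by metis+
qed

text \<open>Each of the ten shuffles collects the $2! \, 3! = 12$ permutations that only reorder the arguments
  inside the two factors; this cancels the normalising factor.\<close>

lemma wedge_2_3_shuffles:
  assumes a2: "alt_form 2 \<alpha>" and a3: "alt_form 3 \<beta>"
  shows "wedge 2 3 \<alpha> \<beta> [a,b,c,d,e] =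
      \<alpha> [a,b] * \<beta> [c,d,e] - \<alpha> [a,c] * \<beta> [b,d,e] + \<alpha> [a,d] * \<beta> [b,c,e] - \<alpha> [a,e] * \<beta> [b,c,d]
    + \<alpha> [b,c] * \<beta> [a,d,e] - \<alpha> [b,d] * \<beta> [a,c,e] + \<alpha> [b,e] * \<beta> [a,c,d]
    + \<alpha> [c,d] * \<beta> [a,b,e] - \<alpha> [c,e] * \<beta> [a,b,d] + \<alpha> [d,e] * \<beta> [a,b,c]"
proof -
  let ?g = "\<lambda>p. \<alpha> [[a,b,c,d,e] ! p 0, [a,b,c,d,e] ! p 1] *
      \<beta> [[a,b,c,d,e] ! p 2, [a,b,c,d,e] ! p 3, [a,b,c,d,e] ! p 4]"
  have "wedge 2 3 \<alpha> \<beta> [a,b,c,d,e] = signed_sum 5 ?g / 12"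
    unfolding wedge_def signed_sum_def
    by (simp add: upt_rec fact_numeral mult.assoc)
  also have "signed_sum 5 ?g = 12 *
     (\<alpha> [a,b] * \<beta> [c,d,e] - \<alpha> [a,c] * \<beta> [b,d,e] + \<alpha> [a,d] * \<beta> [b,c,e] - \<alpha> [a,e] * \<beta> [b,c,d]
    + \<alpha> [b,c] * \<beta> [a,d,e] - \<alpha> [b,d] * \<beta> [a,c,e] + \<alpha> [b,e] * \<beta> [a,c,d]
    + \<alpha> [c,d] * \<beta> [a,b,e] - \<alpha> [c,e] * \<beta> [a,b,d] + \<alpha> [d,e] * \<beta> [a,b,c])"
    unfolding signed_sum_5 signed_sum_4 signed_sum_3
    by (simp add: Transposition.transpose_def
        alt2_swap[OF a2, of b a] alt2_swap[OF a2, of c a] alt2_swap[OF a2, of d a] alt2_swap[OF a2, of e a]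
        alt2_swap[OF a2, of c b] alt2_swap[OF a2, of d b] alt2_swap[OF a2, of e b]
        alt2_swap[OF a2, of d c] alt2_swap[OF a2, of e c] alt2_swap[OF a2, of e d]
        alt3_swaps[OF a3, where x=a and y=b and z=c]
        alt3_swaps[OF a3, where x=a and y=b and z=d]
        alt3_swaps[OF a3, where x=a and y=b and z=e]
        alt3_swaps[OF a3, where x=a and y=c and z=d]
        alt3_swaps[OF a3, where x=a and y=c and z=e]
        alt3_swaps[OF a3, where x=a and y=d and z=e]
        alt3_swaps[OF a3, where x=b and y=c and z=d]
        alt3_swaps[OF a3, where x=b and y=c and z=e]
        alt3_swaps[OF a3, where x=b and y=d and z=e]
        alt3_swaps[OF a3, where x=c and y=d and z=e])
  finally show ?thesis by simp
qed

section \<open>Volume forms in dimension six and Hitchin's endomorphism\<close>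

lemma basis_finite_card:
  fixes B :: "'a::real_vector set"
  assumes "dim (UNIV :: 'a set) = Suc n" "independent B" "span B = UNIV"
  shows "finite B" "card B = Suc n"
proof -
  show "card B = Suc n" using dim_eq_card[of B UNIV] assms by simp
  then show "finite B" using card_ge_0_finite by force
qed

lemma extend_to_basis_list:
  fixes xs :: "'a::real_vector list"
  assumes "dim (UNIV :: 'a set) = Suc n" "independent (set xs)" "distinct xs"
  obtains ys where "independent (set (xs @ ys))" "distinct (xs @ ys)" "span (set (xs @ ys)) = UNIV"
    "length (xs @ ys) = Suc n"
proof -
  let ?B = "extend_basis (set xs)"
  have B: "independent ?B" "span ?B = UNIV" "set xs \<subseteq> ?B"
    using assms(2) by (simp_all add: independent_extend_basis extend_basis_superset)
  have fin: "finite ?B" and card: "card ?B = Suc n"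
    using basis_finite_card[OF assms(1) B(1,2)] by auto
  obtain ys where ys: "set ys = ?B - set xs" "distinct ys"
    using finite_distinct_list[of "?B - set xs"] fin by auto
  have set: "set (xs @ ys) = ?B" and dist: "distinct (xs @ ys)" using ys B assms by auto
  show ?thesis
    by (rule that[of ys]) (use B set dist card distinct_card[OF dist] in auto)
qed

lemma independent_card_spans:
  fixes B :: "'a::real_vector set"
  assumes "dim (UNIV :: 'a set) = Suc n" "independent B" "card B = Suc n"
  shows "span B = UNIV"
proof -
  have E: "independent (extend_basis B)" "span (extend_basis B) = UNIV" "B \<subseteq> extend_basis B"
    using assms(2) by (simp_all add: independent_extend_basis extend_basis_superset)
  then have "B = extend_basis B"
    using basis_finite_card[OF assms(1) E(1,2)] assms(3) by (intro card_subset_eq) auto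
  then show ?thesis using E by simp
qed

locale volume_form =
  fixes \<Omega> :: "'a::real_vector list \<Rightarrow> real"
  assumes dim6: "dim (UNIV :: 'a set) = 6"
    and alt: "alt_form 6 \<Omega>"
    and nonzero: "\<Omega> \<noteq> (\<lambda>_. 0)"
begin

lemma dim_Suc: "dim (UNIV :: 'a set) = Suc 5"
  using dim6 by simp

lemma top_form_eq_0I:
  fixes \<Phi> :: "'a list \<Rightarrow> real"
  assumes \<Phi>: "alt_form 6 \<Phi>" and xs: "independent (set xs)" "distinct xs" "length xs = 6"
    and 0: "\<Phi> xs = 0"
  shows "\<Phi> = (\<lambda>_. 0)"
proof
  obtain ys where "independent (set (xs @ ys))" "distinct (xs @ ys)"
      "span (set (xs @ ys)) = UNIV" "length (xs @ ys) = Suc 5"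
    by (rule extend_to_basis_list[OF dim_Suc xs(1,2)])
  then have span: "span (set xs) = UNIV" using xs(3) by simp
  fix zs show "\<Phi> zs = 0"
  proof (rule alt_form_eq_0I[OF \<Phi> span])
    fix ws assume ws: "length ws = 6" "set ws \<subseteq> set xs" "distinct ws"
    then have "set ws = set xs"
      using xs by (intro card_subset_eq) (auto simp: distinct_card)
    then have "mset ws = mset xs" using ws xs set_eq_iff_mset_eq_distinct by blast
    then show "\<Phi> ws = 0" by (rule alt_form_mset[OF \<Phi>]) fact
  qed
qed

lemma basis_nonzero: "independent (set xs) \<Longrightarrow> distinct xs \<Longrightarrow> length xs = 6 \<Longrightarrow> \<Omega> xs \<noteq> 0"
  using top_form_eq_0I[OF alt] nonzero by blast

lemma basis_list:
  obtains E :: "'a list" where "independent (set E)" "distinct E" "span (set E) = UNIV" "length E = 6"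
proof -
  obtain E :: "'a list" where "independent (set ([] @ E))" "distinct ([] @ E)"
      "span (set ([] @ E)) = UNIV" "length ([] @ E) = Suc 5"
    using extend_to_basis_list[OF dim_Suc, of "[]"] independent_empty by auto
  then show ?thesis using that by simp
qed

text \<open>A nonzero vector in the kernel could be completed to a basis, on which \<open>\<Omega>\<close>
  would vanish.\<close>

lemma contract_inj:
  assumes "contract v \<Omega> = contract w \<Omega>" shows "v = w"
proof (rule ccontr)
  assume "v \<noteq> w"
  then have "independent (set [v - w])" "distinct [v - w]" by simp_all
  then obtain ys where ys: "independent (set ([v - w] @ ys))" "distinct ([v - w] @ ys)"
      "span (set ([v - w] @ ys)) = UNIV" "length ([v - w] @ ys) = Suc 5"
    by (rule extend_to_basis_list[OF dim_Suc])
  then have "\<Omega> ([v - w] @ ys) \<noteq> 0" by (intro basis_nonzero) auto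
  moreover have "linear (\<lambda>u. \<Omega> (([v - w] @ ys)[0 := u]))"
    using alt_form_linear[OF alt, of "[v - w] @ ys" 0] ys by simp
  then have "\<Omega> ((v - w) # ys) = \<Omega> (v # ys) - \<Omega> (w # ys)"
    using linear_diff[of "\<lambda>u. \<Omega> (([v - w] @ ys)[0 := u])"] by simp
  ultimately show False using fun_cong[OF assms, of ys] by (simp add: contract_def)
qed

lemma top_form_proportional:
  fixes \<Phi> :: "'a list \<Rightarrow> real"
  assumes "alt_form 6 \<Phi>" obtains c where "\<Phi> = (\<lambda>xs. c * \<Omega> xs)"
proof -
  obtain E :: "'a list" where E: "independent (set E)" "distinct E" "span (set E) = UNIV" "length E = 6"
    by (rule basis_list)
  note E = E(1,2,4)
  have "(\<lambda>xs. 1 * \<Phi> xs - \<Phi> E / \<Omega> E * \<Omega> xs) = (\<lambda>_. 0)"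
    using basis_nonzero[OF E] by (intro top_form_eq_0I[OF alt_form_diff[OF assms alt] E]) simp
  note eq = fun_cong[OF this]
  have "\<Phi> xs = \<Phi> E / \<Omega> E * \<Omega> xs" for xs using eq[of xs] by simp
  then show ?thesis using that by blast
qed

text \<open>The coefficient of \<open>v\<close> along a basis vector $b$ can be read off by evaluating on the
  five other basis vectors, because \<open>\<Omega>\<close> kills every list with a repetition.\<close>

lemma contract_surj:
  fixes \<gamma> :: "'a list \<Rightarrow> real"
  assumes \<gamma>: "alt_form 5 \<gamma>" obtains v where "contract v \<Omega> = \<gamma>"
proof -
  obtain E :: "'a list" where E: "independent (set E)" "distinct E" "span (set E) = UNIV" "length E = 6"
    by (rule basis_list)
  define rest where "rest b = remove1 b E" for b
  have set_rest: "set (rest b) = set E - {b}" "distinct (rest b)" for b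
    using E(2) by (simp_all add: rest_def)
  have len_rest: "length (rest b) = 5" if "b \<in> set E" for b
    using that E by (simp add: rest_def length_remove1)
  have nz: "\<Omega> (b # rest b) \<noteq> 0" if "b \<in> set E" for b
    using E that set_rest len_rest by (intro basis_nonzero) (auto simp: insert_absorb)
  define v where "v = (\<Sum>b\<in>set E. (\<gamma> (rest b) / \<Omega> (b # rest b)) *\<^sub>R b)"
  have diff: "alt_form 5 (\<lambda>xs. 1 * contract v \<Omega> xs - 1 * \<gamma> xs)"
    using alt by (intro alt_form_diff alt_form_contract \<gamma>) simp
  have "1 * contract v \<Omega> ys - 1 * \<gamma> ys = 0" for ys
  proof (rule alt_form_eq_0I[OF diff E(3)])
    fix xs assume xs: "length xs = 5" "set xs \<subseteq> set E" "distinct xs"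
    have "card (set E - set xs) = 1"
      using xs E by (simp add: card_Diff_subset distinct_card)
    then obtain b where b: "set E - set xs = {b}" using card_1_singletonE by blast
    then have bE: "b \<in> set E" by auto
    have "set xs = set (rest b)" using b xs set_rest by auto
    then have m: "mset xs = mset (rest b)" using xs set_rest set_eq_iff_mset_eq_distinct by blast
    have lin: "linear (\<lambda>w. \<Omega> (w # rest b))"
      using alt_form_linear[OF alt, of "b # rest b" 0] len_rest[OF bE] by simp
    have "contract v \<Omega> (rest b) = (\<Sum>c\<in>set E. \<gamma> (rest c) / \<Omega> (c # rest c) * \<Omega> (c # rest b))"
      unfolding contract_def v_def by (simp add: linear_sum[OF lin] linear_scale[OF lin])
    also have "\<dots> = (\<Sum>c\<in>set E. if c = b then \<gamma> (rest b) else 0)"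
    proof (rule sum.cong[OF refl])
      fix c assume c: "c \<in> set E"
      show "\<gamma> (rest c) / \<Omega> (c # rest c) * \<Omega> (c # rest b) = (if c = b then \<gamma> (rest b) else 0)"
      proof (cases "c = b")
        case False
        then have "\<Omega> (c # rest b) = 0" using c set_rest by (intro alt_form_repeat[OF alt]) auto
        then show ?thesis using False by simp
      qed (use nz bE in simp)
    qed
    also have "\<dots> = \<gamma> (rest b)" using bE by simp
    finally show "1 * contract v \<Omega> xs - 1 * \<gamma> xs = 0"
      using alt_form_mset[OF diff m] by simp
  qed
  then have "contract v \<Omega> = \<gamma>" by (intro ext) simp
  then show ?thesis using that by blast
qed

text \<open>Another presentation $w \otimes \Phi$ of the same 5-form has $\Phi = c \, \Omega$, and then
  $c \, w = v$; hence the tensor $v \otimes \Omega$ does not depend on the presentation.\<close>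

lemma A_iso_contract: "A_iso (contract v \<Omega>) = (\<lambda>xs. \<Omega> xs *\<^sub>R v)"
  unfolding A_iso_def
proof (rule the_equality)
  show "\<exists>w \<Phi>. alt_form 6 \<Phi> \<and> contract w \<Phi> = contract v \<Omega> \<and> (\<lambda>xs. \<Omega> xs *\<^sub>R v) = (\<lambda>xs. \<Phi> xs *\<^sub>R w)"
    using alt by blast
next
  fix T assume "\<exists>w \<Phi>. alt_form 6 \<Phi> \<and> contract w \<Phi> = contract v \<Omega> \<and> T = (\<lambda>xs. \<Phi> xs *\<^sub>R w)"
  then obtain w \<Phi> where \<Phi>: "alt_form 6 \<Phi>" "contract w \<Phi> = contract v \<Omega>" "T = (\<lambda>xs. \<Phi> xs *\<^sub>R w)"
    by blast
  obtain c where c: "\<Phi> = (\<lambda>xs. c * \<Omega> xs)" using top_form_proportional[OF \<Phi>(1)] .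
  have "contract (c *\<^sub>R w) \<Omega> = contract w \<Phi>"
  proof
    fix xs
    show "contract (c *\<^sub>R w) \<Omega> xs = contract w \<Phi> xs"
    proof (cases "length xs = 5")
      case True
      then have "linear (\<lambda>u. \<Omega> (u # xs))" using alt_form_linear[OF alt, of "w # xs" 0] by simp
      then show ?thesis unfolding contract_def c by (simp add: linear_scale[of "\<lambda>u. \<Omega> (u # xs)"])
    next
      case False
      then show ?thesis by (simp add: contract_def c alt_form_length[OF alt])
    qed
  qed
  then have "c *\<^sub>R w = v" using \<Phi>(2) contract_inj by simp
  then show "T = (\<lambda>xs. \<Omega> xs *\<^sub>R v)" using \<Phi>(3) c by (auto simp: mult.commute)
qed

text \<open>The endomorphism $k$ with $K_\rho(v) = k(v) \otimes \Omega$: Hitchin's map $K_\rho$, with the line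
  $\Lambda^6 V^*$ trivialised by \<open>\<Omega>\<close>.\<close>

definition hitchin :: "('a list \<Rightarrow> real) \<Rightarrow> 'a \<Rightarrow> 'a" where
  "hitchin \<rho> v = (THE w. contract w \<Omega> = wedge 2 3 (contract v \<rho>) \<rho>)"

lemma alt_form_5_of_3:
  fixes \<rho> :: "'a list \<Rightarrow> real"
  assumes "alt_form 3 \<rho>" shows "alt_form 5 (wedge 2 3 (contract v \<rho>) \<rho>)"
proof -
  have "alt_form 2 (contract v \<rho>)" using assms by (intro alt_form_contract) simp
  then show ?thesis using alt_form_wedge[OF _ assms, of 2] by simp
qed

lemma contract_hitchin:
  assumes "alt_form 3 \<rho>"
  shows "contract (hitchin \<rho> v) \<Omega> = wedge 2 3 (contract v \<rho>) \<rho>"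
proof -
  obtain w where "contract w \<Omega> = wedge 2 3 (contract v \<rho>) \<rho>"
    using contract_surj[OF alt_form_5_of_3[OF assms]] .
  then show ?thesis unfolding hitchin_def
    by (rule theI[of "\<lambda>w. contract w \<Omega> = wedge 2 3 (contract v \<rho>) \<rho>"]) (use contract_inj \<open>contract w \<Omega> = _\<close> in auto)
qed

lemma K_map_eq: "alt_form 3 \<rho> \<Longrightarrow> K_map \<rho> v = (\<lambda>xs. \<Omega> xs *\<^sub>R hitchin \<rho> v)"
  by (simp add: K_map_def A_iso_contract flip: contract_hitchin)

lemma linear_hd:
  assumes "alt_form (Suc n) \<Phi>" shows "linear (\<lambda>v. \<Phi> (v # xs))"
proof (cases "length xs = n")
  case True
  then show ?thesis using alt_form_linear[OF assms, of "0 # xs" 0] by simp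
next
  case False
  then have "\<Phi> (v # xs) = 0" for v using alt_form_length[OF assms] by simp
  then show ?thesis by (simp add: linear_zero)
qed

lemma linear_hitchin:
  assumes \<rho>: "alt_form 3 \<rho>" shows "linear (hitchin \<rho>)"
proof (rule linearI)
  have lin: "linear (\<lambda>v. contract v \<Omega> xs)" for xs
    using linear_hd[of 5 \<Omega> xs] alt by (simp add: contract_def)
  have lin\<rho>: "linear (\<lambda>v. \<rho> (v # ys))" for ys
    using linear_hd[of 2 \<rho> ys] \<rho> by simp
  have "linear (\<lambda>v. wedge 2 3 (contract v \<rho>) \<rho> xs)" for xs
  proof (cases "length xs = 5")
    case True
    have "linear (\<lambda>v. 1 / (fact 2 * fact 3) * (\<Sum>p | p permutes {..<2 + 3}.
        (of_int (sign p) * \<rho> (map (\<lambda>i. xs ! p i) [2..<2 + 3])) * \<rho> (v # map (\<lambda>i. xs ! p i) [0..<2])))"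
      by (intro linear_real_mult linear_compose_sum ballI lin\<rho>)
    then show ?thesis using True by (simp add: wedge_def contract_def mult_ac)
  qed (simp add: wedge_def linear_zero)
  note w = this
  show "hitchin \<rho> (u + v) = hitchin \<rho> u + hitchin \<rho> v" for u v
    by (rule contract_inj, rule ext)
      (simp add: contract_hitchin[OF \<rho>] linear_add[OF lin] linear_add[OF w])
  show "hitchin \<rho> (c *\<^sub>R v) = c *\<^sub>R hitchin \<rho> v" for c v
    by (rule contract_inj, rule ext)
      (simp add: contract_hitchin[OF \<rho>] linear_scale[OF lin] linear_scale[OF w])
qed

text \<open>Write $k$ for the map above and $\alpha = i_x \rho$. In a basis $x, z, a, b, c, d$ the components
  of $k(x)$ transverse to $x$ and $z$ are, up to sign, the values of $\alpha \wedge \rho$ on $x$,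
  $z$ and three of $a, b, c, d$, that is, the values of
  $i_x(\alpha \wedge \rho) = \alpha \wedge \alpha$ on $z$ and these three. So $\rho(k(x), x, z)$
  is, up to a factor, the value of $i_z \alpha \wedge i_z(\alpha \wedge \alpha) = 2 \, i_z \alpha
  \wedge i_z \alpha \wedge \alpha$ on $a, b, c, d$, and the square of a 1-form is zero.\<close>

lemma form_hitchin_self:
  assumes \<rho>: "alt_form 3 \<rho>" shows "\<rho> [hitchin \<rho> x, x, z] = 0"
proof (cases "independent (set [x, z]) \<and> x \<noteq> z")
  case False
  have lin: "linear (\<lambda>u. \<rho> [hitchin \<rho> x, x, u])" "linear (\<lambda>u. \<rho> [hitchin \<rho> x, u, z])"
    using alt_form_linear[OF \<rho>, of "[hitchin \<rho> x, x, z]" 2] alt_form_linear[OF \<rho>, of "[hitchin \<rho> x, x, z]" 1]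
    by simp_all
  have "x = 0 \<or> (\<exists>c. z = c *\<^sub>R x)"
  proof (rule ccontr)
    assume *: "\<not> (x = 0 \<or> (\<exists>c. z = c *\<^sub>R x))"
    then have "z \<notin> span {x}" by (auto simp: span_singleton)
    then have "independent {z, x}" using * by (simp add: independent_insert)
    then show False using False * by (metis insert_commute list.set(1,2) scaleR_one)
  qed
  then show ?thesis
  proof
    assume "x = 0" then show ?thesis using linear_0[OF lin(2)] by simp
  next
    assume "\<exists>c. z = c *\<^sub>R x"
    then obtain c where "z = c *\<^sub>R x" ..
    moreover have "\<rho> [hitchin \<rho> x, x, x] = 0" by (rule alt_form_repeat[OF \<rho>]) simp
    ultimately show ?thesis using linear_scale[OF lin(1)] by simp
  qed
next
  case True
  then have "independent (set [x, z])" "distinct [x, z]" by simp_all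
  then obtain ys where ys: "independent (set ([x, z] @ ys))" "distinct ([x, z] @ ys)"
      "span (set ([x, z] @ ys)) = UNIV" "length ([x, z] @ ys) = Suc 5"
    by (rule extend_to_basis_list[OF dim_Suc])
  then have "length ys = 4" by simp
  then obtain a b c d where "ys = [a, b, c, d]" by (auto simp: length_Suc_conv numeral_eq_Suc)
  note ys = ys[unfolded this, simplified]
  define m where "m = \<Omega> [x, z, a, b, c, d]"
  have m: "m \<noteq> 0" unfolding m_def using ys by (intro basis_nonzero) auto
  define w where "w = hitchin \<rho> x"
  have "w \<in> span {x, z, a, b, c, d}" using ys by simp
  then obtain r0 r1 ra rb rc rd
    where "w - r0 *\<^sub>R x - r1 *\<^sub>R z - ra *\<^sub>R a - rb *\<^sub>R b - rc *\<^sub>R c - rd *\<^sub>R d = 0"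
    by (auto simp: span_breakdown_eq)
  then have w: "w = r0 *\<^sub>R x + r1 *\<^sub>R z + ra *\<^sub>R a + rb *\<^sub>R b + rc *\<^sub>R c + rd *\<^sub>R d"
    by (simp add: algebra_simps)
  have lin: "linear (\<lambda>v. \<Omega> (v # xs))" for xs using linear_hd[of 5 \<Omega>] alt by simp
  have lin\<rho>: "linear (\<lambda>v. \<rho> (v # xs))" for xs using linear_hd[of 2 \<rho>] \<rho> by simp
  let ?\<gamma> = "wedge 2 3 (contract x \<rho>) \<rho>"
  have \<gamma>: "?\<gamma> xs = r0 * \<Omega> (x # xs) + r1 * \<Omega> (z # xs) + ra * \<Omega> (a # xs) + rb * \<Omega> (b # xs)
      + rc * \<Omega> (c # xs) + rd * \<Omega> (d # xs)" for xs
    using fun_cong[OF contract_hitchin[OF \<rho>, of x], of xs]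
    by (simp add: contract_def flip: w_def) (simp add: w linear_add[OF lin] linear_scale[OF lin])
  note sw = alt_form_swap[OF alt]
  \<comment> \<open>Moving the first entry into its place in the basis costs two, three, four and five swaps.\<close>
  have perm: "\<Omega> [a, x, z, b, c, d] = m" "\<Omega> [b, x, z, a, c, d] = - m"
    "\<Omega> [c, x, z, a, b, d] = m" "\<Omega> [d, x, z, a, b, c] = - m"
    unfolding m_def
    using sw[of "[a, x, z, b, c, d]" 0 1] sw[of "[x, a, z, b, c, d]" 1 2]
      sw[of "[b, x, z, a, c, d]" 0 1] sw[of "[x, b, z, a, c, d]" 1 2] sw[of "[x, z, b, a, c, d]" 2 3]
      sw[of "[c, x, z, a, b, d]" 0 1] sw[of "[x, c, z, a, b, d]" 1 2] sw[of "[x, z, c, a, b, d]" 2 3]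
      sw[of "[x, z, a, c, b, d]" 3 4]
      sw[of "[d, x, z, a, b, c]" 0 1] sw[of "[x, d, z, a, b, c]" 1 2] sw[of "[x, z, d, a, b, c]" 2 3]
      sw[of "[x, z, a, d, b, c]" 3 4] sw[of "[x, z, a, b, d, c]" 4 5]
    by (simp_all add: numeral_eq_Suc)
  have rep: "\<not> distinct xs \<Longrightarrow> \<Omega> xs = 0" for xs by (rule alt_form_repeat[OF alt])
  have coeff: "ra * m = ?\<gamma> [x, z, b, c, d]" "rb * m = - ?\<gamma> [x, z, a, c, d]"
    "rc * m = ?\<gamma> [x, z, a, b, d]" "rd * m = - ?\<gamma> [x, z, a, b, c]"
    by (simp_all add: \<gamma> perm rep)
  have rep\<rho>: "\<not> distinct xs \<Longrightarrow> \<rho> xs = 0" for xs by (rule alt_form_repeat[OF \<rho>])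
  have alt2: "alt_form 2 (contract x \<rho>)" using \<rho> by (intro alt_form_contract) simp
  have "m * \<rho> [w, x, z] = ra * m * \<rho> [a, x, z] + rb * m * \<rho> [b, x, z] + rc * m * \<rho> [c, x, z] + rd * m * \<rho> [d, x, z]"
    by (simp add: w linear_add[OF lin\<rho>] linear_scale[OF lin\<rho>] rep\<rho> algebra_simps)
  also have "\<dots> = 0"
    unfolding coeff wedge_2_3_shuffles[OF alt2 \<rho>] contract_def
    by (simp add: rep\<rho> alt3_swaps(5)[OF \<rho>, where z = a and x = x and y = z]
        alt3_swaps(5)[OF \<rho>, where z = b and x = x and y = z]
        alt3_swaps(5)[OF \<rho>, where z = c and x = x and y = z]
        alt3_swaps(5)[OF \<rho>, where z = d and x = x and y = z] algebra_simps)
  finally show ?thesis using m w_def by simp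
qed

end

section \<open>Inner products, orthonormal frames and traces\<close>

definition orthonormal :: "('a::real_vector \<Rightarrow> 'a \<Rightarrow> real) \<Rightarrow> 'a set \<Rightarrow> bool" where
  "orthonormal h S \<longleftrightarrow> finite S \<and> (\<forall>x\<in>S. \<forall>y\<in>S. h x y = (if x = y then 1 else 0))"

locale metric =
  fixes h :: "'a::real_vector \<Rightarrow> 'a \<Rightarrow> real"
  assumes inner: "is_inner_product h"
begin

lemma bil: "bilinear h" and h_sym: "h x y = h y x" and h_pos: "x \<noteq> 0 \<Longrightarrow> h x x > 0"
  using inner by (auto simp: is_inner_product_def)

lemma h_simps [simp]:
  "h (x + y) z = h x z + h y z" "h z (x + y) = h z x + h z y"
  "h (x - y) z = h x z - h y z" "h z (x - y) = h z x - h z y"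
  "h (c *\<^sub>R x) z = c * h x z" "h z (c *\<^sub>R x) = c * h z x"
  "h (- x) z = - h x z" "h z (- x) = - h z x" "h 0 z = 0" "h z 0 = 0"
  by (simp_all add: bilinear_ladd[OF bil] bilinear_radd[OF bil] bilinear_lsub[OF bil] bilinear_rsub[OF bil]
      bilinear_lmul[OF bil] bilinear_rmul[OF bil] bilinear_lneg[OF bil] bilinear_rneg[OF bil]
      bilinear_lzero[OF bil] bilinear_rzero[OF bil])

lemma h_sum_left: "h (\<Sum>i\<in>I. f i) z = (\<Sum>i\<in>I. h (f i) z)"
  by (induction I rule: infinite_finite_induct) simp_all

lemma h_sum_right: "h z (\<Sum>i\<in>I. f i) = (\<Sum>i\<in>I. h z (f i))"
  by (induction I rule: infinite_finite_induct) simp_all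

lemma h_eq_0_iff: "h x x = 0 \<longleftrightarrow> x = 0"
  using h_pos[of x] by (cases "x = 0") auto

lemma h_nonneg: "h x x \<ge> 0"
  using h_pos[of x] by (cases "x = 0") auto

lemma eqI: assumes "\<And>z. h x z = h y z" shows "x = y"
  using assms[of "x - y"] h_eq_0_iff[of "x - y"] by simp

lemma h_linear_left: "linear (\<lambda>x. h x y)" and h_linear_right: "linear (h x)"
  by (rule linearI; simp)+

lemma perp_span: assumes "\<And>t. t \<in> T \<Longrightarrow> h x t = 0" "y \<in> span T" shows "h x y = 0"
  using assms(2) by (induction rule: span_induct_alt) (use assms(1) in auto)

lemma orthogonal_independent:
  assumes "0 \<notin> S" "\<And>x y. x \<in> S \<Longrightarrow> y \<in> S \<Longrightarrow> x \<noteq> y \<Longrightarrow> h x y = 0"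
  shows "independent S"
  unfolding dependent_def
proof safe
  fix a assume a: "a \<in> S" "a \<in> span (S - {a})"
  have "h a a = 0" by (rule perp_span[OF _ a(2)]) (use a assms(2) in auto)
  then show False using a assms(1) h_eq_0_iff by auto
qed

lemma orthonormal_independent: "orthonormal h S \<Longrightarrow> independent S"
  by (rule orthogonal_independent) (force simp: orthonormal_def)+

lemma orthogonal_residue:
  assumes "orthonormal h S" "t \<in> S" shows "h (x - (\<Sum>s\<in>S. h x s *\<^sub>R s)) t = 0"
proof -
  have "(\<Sum>s\<in>S. h x s * h s t) = (\<Sum>s\<in>S. if s = t then h x t else 0)"
    using assms by (intro sum.cong) (auto simp: orthonormal_def)
  then show ?thesis using assms by (simp add: h_sum_left orthonormal_def)
qed

lemma normalize:
  assumes "w \<noteq> 0" obtains c where "c \<noteq> 0" "h (c *\<^sub>R w) (c *\<^sub>R w) = 1"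
proof -
  define c where "c = 1 / sqrt (h w w)"
  have "c * c * h w w = 1" using h_pos[OF assms] by (simp add: c_def)
  moreover from this have "c \<noteq> 0" by auto
  ultimately show ?thesis using that[of c] by (simp add: mult.assoc)
qed

lemma gram_schmidt:
  assumes "finite T" shows "\<exists>S. orthonormal h S \<and> span S = span T"
  using assms
proof (induction T)
  case empty
  have "orthonormal h {}" by (simp add: orthonormal_def)
  then show ?case by blast
next
  case (insert t T)
  then obtain S where S: "orthonormal h S" "span S = span T" by blast
  define w where "w = t - (\<Sum>s\<in>S. h t s *\<^sub>R s)"
  have proj: "(\<Sum>s\<in>S. h t s *\<^sub>R s) \<in> span S" by (intro span_sum span_scale span_base)
  show ?case
  proof (cases "w = 0")
    case True
    then have "t \<in> span T" using proj S unfolding w_def by simp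
    then have "span (insert t T) = span T" by (simp add: span_redundant)
    then show ?thesis using S by metis
  next
    case False
    obtain c where c: "c \<noteq> 0" "h (c *\<^sub>R w) (c *\<^sub>R w) = 1" using normalize[OF False] .
    have perp: "s \<in> S \<Longrightarrow> h w s = 0" for s unfolding w_def by (rule orthogonal_residue[OF S(1)])
    then have perp': "s \<in> S \<Longrightarrow> h s w = 0" for s using h_sym by metis
    have "c *\<^sub>R w \<notin> S"
    proof
      assume "c *\<^sub>R w \<in> S"
      then have "h w (c *\<^sub>R w) = 0" by (rule perp)
      then show False using c(2) by auto
    qed
    then have "orthonormal h (insert (c *\<^sub>R w) S)"
      using S(1) c(2) perp perp' by (auto simp: orthonormal_def)
    moreover have "span (insert (c *\<^sub>R w) S) = span (insert t S)"
    proof (rule subset_antisym; rule span_minimal[OF _ subspace_span])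
      have "(\<Sum>s\<in>S. h t s *\<^sub>R s) \<in> span (insert t S)"
        using proj span_mono[of S "insert t S"] by blast
      then have "c *\<^sub>R w \<in> span (insert t S)"
        unfolding w_def by (intro span_scale span_diff) (simp_all add: span_base)
      then show "insert (c *\<^sub>R w) S \<subseteq> span (insert t S)" by (simp add: span_base subset_iff)
      have "t = (1 / c) *\<^sub>R (c *\<^sub>R w) + (\<Sum>s\<in>S. h t s *\<^sub>R s)" using c by (simp add: w_def)
      moreover have "(\<Sum>s\<in>S. h t s *\<^sub>R s) \<in> span (insert (c *\<^sub>R w) S)"
        using proj span_mono[of S "insert (c *\<^sub>R w) S"] by auto
      ultimately have "t \<in> span (insert (c *\<^sub>R w) S)" by (metis insertI1 span_add span_base span_scale)
      then show "insert t S \<subseteq> span (insert (c *\<^sub>R w) S)" by (auto intro: span_base)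
    qed
    moreover have "span (insert t S) = span (insert t T)" using S(2) by (simp add: span_insert)
    ultimately show ?thesis by metis
  qed
qed

lemma orthogonal_vector_exists:
  assumes "finite T" "span T \<noteq> UNIV" obtains w where "w \<noteq> 0" "\<And>t. t \<in> T \<Longrightarrow> h w t = 0"
proof -
  obtain S where S: "orthonormal h S" "span S = span T" using gram_schmidt[OF assms(1)] by blast
  obtain x where x: "x \<notin> span S" using assms(2) S(2) by auto
  define w where "w = x - (\<Sum>s\<in>S. h x s *\<^sub>R s)"
  have "(\<Sum>s\<in>S. h x s *\<^sub>R s) \<in> span S" by (intro span_sum span_scale span_base)
  then have "w \<noteq> 0" using x unfolding w_def by auto
  moreover have "h w t = 0" if "t \<in> T" for t
  proof (rule perp_span[of S])
    show "h w s = 0" if "s \<in> S" for s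
      unfolding w_def using orthogonal_residue[OF S(1) that] .
    show "t \<in> span S" using that S(2) by (simp add: span_base)
  qed
  ultimately show ?thesis using that by blast
qed

lemma orthonormal_basis_exists:
  assumes "dim (UNIV :: 'a set) = Suc n"
  obtains B where "orthonormal h B" "span B = UNIV"
proof -
  let ?T = "extend_basis ({} :: 'a set)"
  have T: "independent ?T" "span ?T = UNIV" by (simp_all add: independent_extend_basis independent_empty)
  show ?thesis
    using gram_schmidt[OF basis_finite_card(1)[OF assms T]] T(2) that by auto
qed

end

locale orthonormal_frame = metric h
  for h :: "'a::real_vector \<Rightarrow> 'a \<Rightarrow> real" +
  fixes B :: "'a set"
  assumes orthonormal: "orthonormal h B" and span_B: "span B = UNIV"
begin

lemma fin: "finite B"
  using orthonormal by (simp add: orthonormal_def)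

lemma h_basis: "a \<in> B \<Longrightarrow> b \<in> B \<Longrightarrow> h a b = (if a = b then 1 else 0)"
  using orthonormal by (simp add: orthonormal_def)

lemma expand: "x = (\<Sum>b\<in>B. h x b *\<^sub>R b)"
proof -
  let ?w = "x - (\<Sum>b\<in>B. h x b *\<^sub>R b)"
  have "h ?w ?w = 0"
    by (rule perp_span[of B], rule orthogonal_residue[OF orthonormal]) (simp_all add: span_B)
  then have "?w = 0" by (simp only: h_eq_0_iff)
  then show ?thesis by simp
qed

lemma linear_expand: "linear f \<Longrightarrow> f x = (\<Sum>b\<in>B. h x b *\<^sub>R f b)"
  by (subst expand[of x]) (simp add: linear_sum linear_scale)

lemma eq_on_basis: assumes "\<And>b. b \<in> B \<Longrightarrow> h x b = h y b" shows "x = y"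
  using expand[of x] expand[of y] assms by simp

definition tr :: "('a \<Rightarrow> 'a) \<Rightarrow> real" where "tr f = (\<Sum>b\<in>B. h (f b) b)"

lemma tr_comm:
  assumes "linear f" "linear g" shows "tr (\<lambda>x. f (g x)) = tr (\<lambda>x. g (f x))"
proof -
  have *: "h (f (g b)) b = (\<Sum>c\<in>B. h (g b) c * h (f c) b)" if "linear f" for f g :: "'a \<Rightarrow> 'a" and b
    by (subst linear_expand[OF that]) (simp add: h_sum_left)
  have "tr (\<lambda>x. f (g x)) = (\<Sum>b\<in>B. \<Sum>c\<in>B. h (g b) c * h (f c) b)"
    unfolding tr_def by (intro sum.cong refl *[OF assms(1)])
  also have "\<dots> = (\<Sum>b\<in>B. \<Sum>c\<in>B. h (f b) c * h (g c) b)"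
    by (subst sum.swap) (simp add: mult.commute)
  also have "\<dots> = tr (\<lambda>x. g (f x))"
    unfolding tr_def by (intro sum.cong refl *[OF assms(2), symmetric])
  finally show ?thesis .
qed

lemma tr_endo_trace:
  assumes f: "linear f" shows "endo_trace f = tr f"
proof -
  let ?C = "extend_basis ({} :: 'a set)" and ?r = "representation (extend_basis ({} :: 'a set))"
  have C: "independent ?C" "span ?C = UNIV" by (simp_all add: independent_extend_basis independent_empty)
  have finC: "finite ?C" using independent_span_bound[OF fin C(1)] span_B by simp
  have lin: "linear (\<lambda>x. ?r x c)" for c
    by (rule linearI) (simp_all add: representation_add[OF C(1)] representation_scale[OF C(1)] C(2))
  have "?r (f c) c = (\<Sum>b\<in>B. h (f c) b * ?r b c)" for c
    using linear_expand[OF lin[of c], of "f c"] by (simp only: real_scaleR_def)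
  then have "endo_trace f = (\<Sum>c\<in>?C. \<Sum>b\<in>B. h (f c) b * ?r b c)"
    by (simp only: endo_trace_def Let_def)
  also have "\<dots> = (\<Sum>b\<in>B. \<Sum>c\<in>?C. ?r b c * h (f c) b)"
    by (subst sum.swap) (simp add: mult.commute)
  also have "\<dots> = (\<Sum>b\<in>B. h (f (\<Sum>c\<in>?C. ?r b c *\<^sub>R c)) b)"
    by (simp add: linear_sum[OF f] linear_scale[OF f] h_sum_left)
  also have "\<dots> = tr f"
    unfolding tr_def using sum_representation_eq[OF C(1), of _ ?C] C(2) finC by simp
  finally show ?thesis .
qed

end

section \<open>Eigenvectors of symmetric maps\<close>

lemma quadratic_dominates_linear:
  fixes g k :: real
  assumes "\<And>t. 2 * t * g \<le> t\<^sup>2 * k" shows "g = 0"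
proof (rule ccontr)
  assume "g \<noteq> 0"
  define m where "m = \<bar>k\<bar> + 1"
  have m: "m > 0" "k < m" by (auto simp: m_def)
  have "2 * (g / m) * g \<le> (g / m)\<^sup>2 * k" using assms .
  also have "\<dots> \<le> (g / m)\<^sup>2 * m" using m by (intro mult_left_mono) auto
  finally have "2 * g\<^sup>2 / m \<le> g\<^sup>2 / m" using m by (simp add: power2_eq_square field_simps)
  then show False using \<open>g \<noteq> 0\<close> m by (simp add: divide_right_mono_neg field_simps)
qed

context metric
begin

text \<open>A maximum $u$ of $h(Ax, x)$ on the unit sphere of $U$ is an eigenvector: with $s = h(Au, u)$, the
  form $s \, h(x, x) - h(Ax, x)$ is nonnegative on $U$ and zero at $u$, so its derivative at $u$
  in the direction $w = Au - su$, which is $-2 h(w, w)$, must vanish. The maximum exists because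
  $h$ is isometric to the Euclidean space of dimension six, whose spheres are compact.\<close>

lemma symmetric_eigenvector:
  assumes dim: "dim (UNIV :: 'a set) = 6"
    and A: "linear A" and sym: "\<And>x y. h (A x) y = h x (A y)"
    and U: "subspace U" "U \<noteq> {0}" and inv: "\<And>x. x \<in> U \<Longrightarrow> A x \<in> U"
  obtains u s where "u \<in> U" "h u u = 1" "A u = s *\<^sub>R u"
proof -
  obtain B where B: "orthonormal h B" "span B = UNIV"
    using orthonormal_basis_exists[of 5] dim by auto
  interpret orthonormal_frame h B by unfold_locales fact+
  have "card B = 6"
    using basis_finite_card(2)[of 5 B] dim orthonormal_independent[OF B(1)] B(2) by simp
  then obtain e :: "6 \<Rightarrow> 'a" where e: "bij_betw e UNIV B"
    using finite_same_card_bij[of "UNIV :: 6 set" B] fin by auto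
  define L :: "real^6 \<Rightarrow> 'a" where "L c = (\<Sum>i\<in>UNIV. (c $ i) *\<^sub>R e i)" for c
  have linL: "linear L"
    by (rule linearI) (simp_all add: L_def scaleR_add_left sum.distrib scaleR_sum_right)
  have e_orth: "h (e i) (e j) = (if i = j then 1 else 0)" for i j
    using e h_basis by (auto simp: bij_betw_def inj_eq)
  have hL: "h (L c) (L c) = (norm c)\<^sup>2" for c
    by (simp add: L_def h_sum_left h_sum_right e_orth power2_norm_eq_inner inner_vec_def
        if_distrib cong: if_cong)
  have unit: "c \<in> sphere 0 1" if "h (L c) (L c) = 1" for c
  proof -
    have "(norm c)\<^sup>2 = 1\<^sup>2" using hL[of c] that by simp
    then show ?thesis using power2_eq_imp_eq[of "norm c" 1] by simp
  qed
  have surj: "\<exists>c. x = L c" for x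
  proof
    have "x = (\<Sum>b\<in>B. h x b *\<^sub>R b)" by (rule expand)
    also have "\<dots> = L (\<chi> i. h x (e i))" unfolding L_def
      using sum.reindex_bij_betw[OF e, of "\<lambda>b. h x b *\<^sub>R b"] by simp
    finally show "x = L (\<chi> i. h x (e i))" .
  qed
  define q where "q c = h (A (L c)) (L c)" for c
  have cont: "continuous_on X q" for X
  proof -
    have "q = (\<lambda>c. \<Sum>i\<in>UNIV. \<Sum>j\<in>UNIV. c $ i * (c $ j * h (A (e j)) (e i)))"
      by (simp add: fun_eq_iff q_def L_def linear_sum[OF A] linear_scale[OF A] h_sum_left h_sum_right)
        (simp add: sum_distrib_left)
    then show ?thesis by (simp add: continuous_intros)
  qed
  have "subspace (L -` U)"
    using U(1) linL by (simp add: linear_subspace_vimage)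
  then have "compact (sphere 0 1 \<inter> L -` U)"
    by (intro compact_Int_closed compact_sphere closed_subspace)
  moreover obtain x where x: "x \<in> U" "x \<noteq> 0" using U subspace_0 by blast
  obtain r where r: "h (r *\<^sub>R x) (r *\<^sub>R x) = 1" using normalize[OF x(2)] .
  obtain c where c: "r *\<^sub>R x = L c" using surj by blast
  have "c \<in> sphere 0 1 \<inter> L -` U"
    using unit[of c] r c x(1) U(1) subspace_scale[of U x r] by simp
  then have "sphere 0 1 \<inter> L -` U \<noteq> {}" by blast
  ultimately obtain m where m: "m \<in> sphere 0 1 \<inter> L -` U"
    and max: "\<And>c. c \<in> sphere 0 1 \<inter> L -` U \<Longrightarrow> q c \<le> q m"
    using continuous_attains_sup[OF _ _ cont] by metis
  define u where "u = L m"
  define s where "s = q m"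
  have u: "u \<in> U" "h u u = 1" using m hL[of m] by (auto simp: u_def)
  have bound: "h (A w) w \<le> s * h w w" if "w \<in> U" for w
  proof (cases "w = 0")
    case False
    obtain r where r: "r \<noteq> 0" "h (r *\<^sub>R w) (r *\<^sub>R w) = 1" using normalize[OF False] .
    obtain c where c: "r *\<^sub>R w = L c" using surj by blast
    have "c \<in> sphere 0 1 \<inter> L -` U"
      using unit[of c] r c that U(1) subspace_scale[of U w r] by simp
    then have "q c \<le> s" using max s_def by simp
    then have "r * r * h (A w) w \<le> s"
      unfolding q_def c[symmetric] by (simp add: linear_scale[OF A] mult.assoc)
    also have "\<dots> = s * (r * r * h w w)" using r(2) by (simp add: mult.assoc)
    finally have "(r * r) * h (A w) w \<le> (r * r) * (s * h w w)" by (simp add: mult_ac)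
    moreover have "r * r > 0" using not_real_square_gt_zero[of r] r(1) by blast
    ultimately show ?thesis by (metis mult_le_cancel_left_pos)
  qed (simp add: linear_0[OF A])
  define w where "w = A u - s *\<^sub>R u"
  have w: "w \<in> U" unfolding w_def using u inv U(1) by (intro subspace_diff subspace_scale) auto
  have "h w w = 0"
  proof (rule quadratic_dominates_linear)
    fix t
    have "h (A (u + t *\<^sub>R w)) (u + t *\<^sub>R w) \<le> s * h (u + t *\<^sub>R w) (u + t *\<^sub>R w)"
      using w u U(1) by (intro bound subspace_add subspace_scale) auto
    moreover have "h (A w) u = h w (A u)" "h (A u) w = h w (A u)" "h u w = h w u" "h (A u) u = s"
      using sym[of w u] h_sym by (auto simp: s_def q_def u_def)
    ultimately have "2 * t * (h w (A u) - s * h w u) \<le> t\<^sup>2 * (s * h w w - h (A w) w)"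
      using u by (simp add: linear_add[OF A] linear_scale[OF A] algebra_simps power2_eq_square)
    moreover have "h w w = h w (A u) - s * h w u" by (simp add: w_def)
    ultimately show "2 * t * h w w \<le> t\<^sup>2 * (s * h w w - h (A w) w)" by simp
  qed
  then have "w = 0" by (simp only: h_eq_0_iff)
  then have "A u = s *\<^sub>R u" by (simp add: w_def)
  then show ?thesis using that u by blast
qed

text \<open>Choose the eigenvectors one after the other, each in the orthogonal complement of the earlier ones
  and their images under \<open>J\<close>. This complement is invariant under the symmetric map
  \<open>A\<close>, since \<open>A\<close> commutes with \<open>J\<close>. Because
  \<open>J \<circ> J\<close> acts as a scalar on every eigenvector, the planes spanned by $u$ and
  $Ju$ are invariant under \<open>J\<close> and mutually orthogonal. This serves to diagonalise
  \<open>J \<circ> J\<close> while it is not yet known to be $-1$, and later the torsion of a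
  coupled structure.\<close>

lemma skew_invariant_eigenframe:
  assumes dim: "dim (UNIV :: 'a set) = 6"
    and J: "linear J" "\<And>x y. h (J x) y = - h x (J y)" "\<And>x. J x = 0 \<Longrightarrow> x = 0"
    and A: "linear A" "\<And>x y. h (A x) y = h x (A y)" "\<And>x. A (J x) = J (A x)"
    and JJ: "\<And>u s. A u = s *\<^sub>R u \<Longrightarrow> \<exists>k. J (J u) = k *\<^sub>R u"
  obtains u1 u2 u3 s1 s2 s3 where
    "A u1 = s1 *\<^sub>R u1" "A u2 = s2 *\<^sub>R u2" "A u3 = s3 *\<^sub>R u3"
    "h u1 u1 = 1" "h u2 u2 = 1" "h u3 u3 = 1" "h u1 u2 = 0" "h u1 u3 = 0" "h u2 u3 = 0"
    "h u1 (J u2) = 0" "h u1 (J u3) = 0" "h u2 (J u3) = 0"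
    "span {u1, J u1, u2, J u2, u3, J u3} = UNIV"
proof -
  have hJ: "h x (J x) = 0" for x using J(2)[of x x] h_sym[of "J x" x] by simp
  have next_vec: "\<exists>u s. h u u = 1 \<and> A u = s *\<^sub>R u \<and> (\<forall>v\<in>S. h u v = 0 \<and> h u (J v) = 0)"
    if S: "finite S" "2 * card S < 6" "\<And>v. v \<in> S \<Longrightarrow> \<exists>s. A v = s *\<^sub>R v" for S
  proof -
    let ?T = "S \<union> J ` S"
    define U where "U = {x. \<forall>t\<in>?T. h x t = 0}"
    have "card ?T < 6" using card_Un_le[of S "J ` S"] card_image_le[OF S(1), of J] S(2) by linarith
    moreover have "card ?T \<ge> 6" if "span ?T = UNIV"
    proof -
      obtain C where "C \<subseteq> ?T" "independent C" "?T \<subseteq> span C" using maximal_independent_subset[of ?T] by blast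
      then have "independent C" "span C = UNIV" "card C \<le> card ?T"
        using that S(1) span_mono[of ?T "span C"] by (auto simp: span_span intro!: card_mono)
      then show ?thesis using basis_finite_card(2)[of 5 C] dim by simp
    qed
    ultimately have "span ?T \<noteq> UNIV" by linarith
    then obtain w where "w \<noteq> 0" "\<And>t. t \<in> ?T \<Longrightarrow> h w t = 0"
      using orthogonal_vector_exists[of ?T] S(1) by blast
    then have ne: "U \<noteq> {0}" by (auto simp: U_def)
    have sub: "subspace U" by (auto simp: U_def subspace_def)
    have inv: "A x \<in> U" if x: "x \<in> U" for x
      unfolding U_def
    proof safe
      fix v assume "v \<in> S"
      then obtain s where s: "A v = s *\<^sub>R v" using S(3) by blast
      show "h (A x) v = 0" "h (A x) (J v) = 0"
        using x \<open>v \<in> S\<close> s by (auto simp: U_def A(2,3) linear_scale[OF J(1)])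
    qed
    obtain u s where "u \<in> U" "h u u = 1" "A u = s *\<^sub>R u"
      using symmetric_eigenvector[OF dim A(1,2) sub ne inv] .
    then show ?thesis by (auto simp: U_def)
  qed
  obtain u1 s1 where u1: "h u1 u1 = 1" "A u1 = s1 *\<^sub>R u1" using next_vec[of "{}"] by auto
  obtain u2 s2 where u2: "h u2 u2 = 1" "A u2 = s2 *\<^sub>R u2" "h u2 u1 = 0" "h u2 (J u1) = 0"
    using next_vec[of "{u1}"] u1 by auto
  have "card {u1, u2} \<le> 2" by (simp add: card_insert_le_m1)
  then obtain u3 s3 where u3: "h u3 u3 = 1" "A u3 = s3 *\<^sub>R u3" "h u3 u1 = 0" "h u3 (J u1) = 0"
      "h u3 u2 = 0" "h u3 (J u2) = 0"
    using next_vec[of "{u1, u2}"] u1 u2 by auto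
  obtain k1 k2 k3 where k: "J (J u1) = k1 *\<^sub>R u1" "J (J u2) = k2 *\<^sub>R u2" "J (J u3) = k3 *\<^sub>R u3"
    using JJ u1(2) u2(2) u3(2) by metis
  have o: "h u1 u2 = 0" "h u1 u3 = 0" "h u2 u3 = 0" "h u1 (J u2) = 0" "h u1 (J u3) = 0" "h u2 (J u3) = 0"
    using u2(3) u3(3,5) h_sym[of u1 u2] h_sym[of u1 u3] h_sym[of u2 u3]
      J(2)[of u1 u2] J(2)[of u1 u3] J(2)[of u2 u3] u2(4) u3(4,6)
      h_sym[of "J u1" u2] h_sym[of "J u1" u3] h_sym[of "J u2" u3] by simp_all
  have orth: "h u1 (J u1) = 0" "h u2 (J u2) = 0" "h u3 (J u3) = 0"
    "h (J u1) (J u2) = 0" "h (J u1) (J u3) = 0" "h (J u2) (J u3) = 0"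
    using hJ o by (simp_all add: J(2) k)
  note all = o orth u2(3,4) u3(3-6)
  have sym0: "h y x = 0" if "h x y = 0" for x y using that h_sym[of x y] by simp
  note all0 = all[THEN sym0]
  have nz: "u1 \<noteq> 0" "u2 \<noteq> 0" "u3 \<noteq> 0" using u1(1) u2(1) u3(1) by auto
  then have nzJ: "J u1 \<noteq> 0" "J u2 \<noteq> 0" "J u3 \<noteq> 0" using J(3) by auto
  then have posJ: "h (J u1) (J u1) \<noteq> 0" "h (J u2) (J u2) \<noteq> 0" "h (J u3) (J u3) \<noteq> 0"
    using h_eq_0_iff by auto
  let ?B = "{u1, J u1, u2, J u2, u3, J u3}"
  have ind: "independent ?B"
  proof (rule orthogonal_independent)
    show "0 \<notin> ?B" using nz nzJ by auto
    fix x y assume "x \<in> ?B" "y \<in> ?B" "x \<noteq> y"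
    then show "h x y = 0" by (elim insertE emptyE; simp add: all all0)
  qed
  have "card ?B = 6"
  proof -
    have ne: "x \<noteq> y" if "h x x \<noteq> 0" "h x y = 0" for x y using that by auto
    have posu: "h u1 u1 \<noteq> 0" "h u2 u2 \<noteq> 0" "h u3 u3 \<noteq> 0" using u1(1) u2(1) u3(1) by simp_all
    have d: "u1 \<noteq> J u1" "u1 \<noteq> u2" "u1 \<noteq> J u2" "u1 \<noteq> u3" "u1 \<noteq> J u3"
      "J u1 \<noteq> u2" "J u1 \<noteq> J u2" "J u1 \<noteq> u3" "J u1 \<noteq> J u3" "u2 \<noteq> J u2"
      "u2 \<noteq> u3" "u2 \<noteq> J u3" "J u2 \<noteq> u3" "J u2 \<noteq> J u3" "u3 \<noteq> J u3"
      by (rule ne, (rule posu posJ), rule all all0)+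
    then show ?thesis by simp
  qed
  then have "span ?B = UNIV" using independent_card_spans[of 5 ?B] ind dim by simp
  then show ?thesis using that u1 u2 u3 o by blast
qed

end

section \<open>The complex structure of an SU(3)-structure\<close>

lemma alt_form_cube:
  fixes \<omega> :: "'a::real_vector list \<Rightarrow> real"
  assumes "alt_form 2 \<omega>" shows "alt_form 6 (cube \<omega>)"
proof -
  have "alt_form 4 (wedge 2 2 \<omega> \<omega>)" using alt_form_wedge[OF assms assms] by simp
  then show ?thesis unfolding cube_def using alt_form_wedge[OF _ assms, of 4] by simp
qed

text \<open>Decompose the space into the three eigenplanes of \<open>J \<circ> J\<close>. The form
  \<open>\<psi>\<close> vanishes on two vectors of the same plane by its compatibility with
  \<open>J\<close>, and on vectors of two planes with different eigenvalues because
  \<open>J \<circ> J\<close> can be moved from one argument to the other. If two eigenvalues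
  differed, every triple of frame vectors would contain such a pair, and \<open>\<psi>\<close>
  would be zero.\<close>

lemma (in metric) skew_form_symmetric_square:
  fixes \<psi> :: "'a list \<Rightarrow> real"
  assumes dim: "dim (UNIV :: 'a set) = 6" and \<psi>: "alt_form 3 \<psi>" "\<psi> \<noteq> (\<lambda>_. 0)"
    and J: "linear J" "\<And>x y. h (J x) y = - h x (J y)" "\<And>x. J x = 0 \<Longrightarrow> x = 0"
    and \<psi>J: "\<And>x y z. \<psi> [J x, y, z] = \<psi> [x, J y, z]"
  obtains s where "\<And>x. J (J x) = s *\<^sub>R x"
proof -
  note sw = alt3_swaps[OF \<psi>(1)]
  have null: "\<psi> [y, x, z] = 0 \<and> \<psi> [x, y, z] = 0 \<and> \<psi> [z, x, y] = 0 \<and> \<psi> [z, y, x] = 0 \<and> \<psi> [x, z, y] = 0 \<and> \<psi> [y, z, x] = 0"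
    if "\<And>z. \<psi> [x, y, z] = 0" for x y z
    using that[of z] sw[of y x z] sw(2)[of x z y] sw(3)[of z y x] sw(4)[of y z x] sw(5)[of z x y] by (metis minus_zero)
  have self: "\<psi> [x, x, z] = 0" for x z by (rule alt_form_repeat[OF \<psi>(1)]) simp
  have self2: "\<psi> [x, J x, z] = 0" for x z
    using \<psi>J[of x x z] sw(1)[of "J x" x z] by simp
  have lin: "linear (\<lambda>x. \<psi> [x, y, z])" for y z
    using alt_form_linear[OF \<psi>(1), of "[0, y, z]" 0] by simp
  have lin2: "linear (\<lambda>y. \<psi> [x, y, z])" for x z
    using alt_form_linear[OF \<psi>(1), of "[x, 0, z]" 1] by simp
  have eigen: "\<psi> [x, y, z] = 0" if "J (J x) = s *\<^sub>R x" "J (J y) = t *\<^sub>R y" "s \<noteq> t" for x y z s t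
  proof -
    have "\<psi> [J (J x), y, z] = \<psi> [x, J (J y), z]" by (simp add: \<psi>J)
    then have "s * \<psi> [x, y, z] = t * \<psi> [x, y, z]"
      by (simp add: that linear_scale[OF lin] linear_scale[OF lin2])
    then show ?thesis using that(3) by simp
  qed
  have same: "s = t" if a: "J (J a) = s *\<^sub>R a" and b: "J (J b) = t *\<^sub>R b"
    and span: "span {a, J a, b, J b, c, J c} = UNIV" for a b c s t
  proof (rule ccontr)
    assume st: "s \<noteq> t"
    have Ja: "J (J (J a)) = s *\<^sub>R J a" and Jb: "J (J (J b)) = t *\<^sub>R J b"
      using a b by (simp_all add: linear_scale[OF J(1)])
    note zeros = null[OF self] null[OF self2] null[OF eigen[OF a b st]] null[OF eigen[OF a Jb st]]
      null[OF eigen[OF Ja b st]] null[OF eigen[OF Ja Jb st]]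
    have "\<psi> xs = 0" for xs
    proof (rule alt_form_eq_0I[OF \<psi>(1) span])
      fix xs :: "'a list" assume "length xs = 3" "set xs \<subseteq> {a, J a, b, J b, c, J c}"
      then obtain x y z where xs: "xs = [x, y, z]" by (auto simp: length_Suc_conv numeral_eq_Suc)
      have "x \<in> {a, J a, b, J b, c, J c}" "y \<in> {a, J a, b, J b, c, J c}" "z \<in> {a, J a, b, J b, c, J c}"
        using \<open>set xs \<subseteq> _\<close> xs by auto
      then show "\<psi> xs = 0" unfolding xs by (elim insertE emptyE; simp add: zeros)
    qed
    then show False using \<psi>(2) by blast
  qed
  have A: "linear (\<lambda>x. J (J x))" using linear_compose[OF J(1) J(1)] by (simp add: o_def)
  obtain u1 u2 u3 s1 s2 s3 where u: "J (J u1) = s1 *\<^sub>R u1" "J (J u2) = s2 *\<^sub>R u2" "J (J u3) = s3 *\<^sub>R u3"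
    and span: "span {u1, J u1, u2, J u2, u3, J u3} = UNIV"
    by (rule skew_invariant_eigenframe[OF dim J(1,2) _ A]) (auto simp: J(2) dest!: J(3))
  have "s1 = s2" using same[OF u(1,2) span] .
  moreover have "s1 = s3" by (rule same[OF u(1,3), of u2]) (use span in \<open>simp add: insert_commute\<close>)
  ultimately have eq: "J (J x) = s1 *\<^sub>R x" if "x \<in> {u1, J u1, u2, J u2, u3, J u3}" for x
    using that u by (auto simp: linear_scale[OF J(1)])
  have "J (J x) = s1 *\<^sub>R x" for x
    using linear_eq_on[OF A linear_scaleR _ eq] span by blast
  then show ?thesis using that by blast
qed

text \<open>Up to a positive factor \<open>J\<close> is the negative of Hitchin's endomorphism of
  \<open>\<psi>\<close>, computed with the volume form $\omega^3$. Polarising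
  $\psi(k(x), x, z) = 0$ shows that $J$ can be moved between the arguments of
  \<open>\<psi>\<close>. Since $h = \omega(\cdot, J \cdot)$ is symmetric, $J$ is skew for
  \<open>h\<close>, so $J^2$ is a multiple of the identity; the definition of $\sqrt{|\lambda|}$
  gives $\mathrm{tr} J^2 = -6$, and the multiple is $-1$.\<close>

theorem SU3_structure_complex:
  fixes \<omega> \<psi> :: "'a::real_vector list \<Rightarrow> real"
  assumes dim: "dim (UNIV :: 'a set) = 6" and SU3: "SU3_structure \<omega> \<psi>"
  defines "J \<equiv> J_map \<omega> \<psi>" and "h \<equiv> induced_metric \<omega> \<psi>"
  shows "linear J" "\<And>x. J (J x) = - x" "\<And>x y. h (J x) y = - h x (J y)" "\<And>x y. \<omega> [x, y] = h (J x) y"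
    "\<And>x y z. \<psi> [J x, y, z] = \<psi> [x, J y, z]" "\<psi> \<noteq> (\<lambda>_. 0)"
proof -
  have \<omega>: "alt_form 2 \<omega>" "cube \<omega> \<noteq> (\<lambda>_. 0)" and \<psi>: "alt_form 3 \<psi>" and neg: "lam_negative \<psi>"
    and inner: "is_inner_product h"
    using SU3 by (auto simp: SU3_structure_def stable2_def h_def)
  interpret vol: volume_form "cube \<omega>"
    using dim \<omega> alt_form_cube by unfold_locales auto
  interpret metric h by unfold_locales fact
  obtain B where "orthonormal h B" "span B = UNIV"
    using orthonormal_basis_exists[of 5] dim by auto
  then interpret orthonormal_frame h B by unfold_locales
  let ?\<Omega> = "cube \<omega>"
  define k where "k = vol.hitchin \<psi>"
  have k: "linear k" unfolding k_def by (rule vol.linear_hitchin[OF \<psi>])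
  have K: "K_map \<psi> v = (\<lambda>xs. ?\<Omega> xs *\<^sub>R k v)" for v
    unfolding k_def by (rule vol.K_map_eq[OF \<psi>])
  have kk: "linear (\<lambda>x. k (k x))" using linear_compose[OF k k] by (simp add: o_def)
  define q where "q = tr (\<lambda>x. k (k x)) / 6"
  have lam: "lam \<psi> xs ys = ?\<Omega> xs * ?\<Omega> ys * q" for xs ys
  proof -
    have "linear (\<lambda>v. (?\<Omega> ys * ?\<Omega> xs) *\<^sub>R k (k v))" by (rule linear_compose_scale_right[OF kk])
    then show ?thesis
      unfolding lam_def K linear_scale[OF k] scaleR_scaleR
      by (simp add: tr_endo_trace) (simp add: tr_def q_def sum_distrib_left mult.commute)
  qed
  have q: "q < 0"
  proof -
    obtain xs where "?\<Omega> xs * ?\<Omega> xs * q < 0" using neg by (auto simp: lam_negative_def lam)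
    then show ?thesis using zero_le_square[of "?\<Omega> xs"] by (auto simp: mult_less_0_iff)
  qed
  define r where "r = sqrt (- q)"
  have r: "r > 0" "r * r = - q" using q by (auto simp: r_def)
  have sqrt_lam: "sqrt_lam \<omega> \<psi> xs = ?\<Omega> xs * r" for xs
  proof -
    have "\<bar>lam \<psi> xs xs\<bar> = (?\<Omega> xs)\<^sup>2 * (- q)" using q by (simp add: lam abs_mult power2_eq_square)
    then have "sqrt_lam \<omega> \<psi> xs = sgn (?\<Omega> xs) * \<bar>?\<Omega> xs\<bar> * r"
      by (simp only: sqrt_lam_def real_sqrt_mult real_sqrt_abs r_def mult.assoc)
    then show ?thesis by (simp only: mult_sgn_abs mult.commute[of "sgn _"] abs_mult_sgn)
  qed
  obtain zs where zs: "?\<Omega> zs \<noteq> 0" using \<omega>(2) by blast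
  have J_eq: "J v = - (1 / r) *\<^sub>R k v" for v
    unfolding J_def J_map_def K sqrt_lam
  proof (rule the_equality)
    show "(\<lambda>xs. ?\<Omega> xs *\<^sub>R k v) = (\<lambda>xs. - ((?\<Omega> xs * r) *\<^sub>R (- (1 / r) *\<^sub>R k v)))"
      using r(1) by simp
    fix w assume "(\<lambda>xs. ?\<Omega> xs *\<^sub>R k v) = (\<lambda>xs. - ((?\<Omega> xs * r) *\<^sub>R w))"
    from fun_cong[OF this, of zs] have "?\<Omega> zs *\<^sub>R k v = ?\<Omega> zs *\<^sub>R (- (r *\<^sub>R w))" by simp
    then have "k v = - (r *\<^sub>R w)" using zs scaleR_left_imp_eq by blast
    then show "w = - (1 / r) *\<^sub>R k v" using r(1) by simp
  qed
  show J: "linear J" unfolding J_eq[abs_def] by (rule linear_compose_scale_right[OF k])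
  have k_sym: "\<psi> [k x, y, z] = \<psi> [x, k y, z]" for x y z
  proof -
    have lin: "linear (\<lambda>x. \<psi> [x, y, z])" for y z
      using alt_form_linear[OF \<psi>, of "[0, y, z]" 0] by simp
    have lin2: "linear (\<lambda>y. \<psi> [x, y, z])" for x z
      using alt_form_linear[OF \<psi>, of "[x, 0, z]" 1] by simp
    have self: "\<psi> [k v, v, z] = 0" for v unfolding k_def by (rule vol.form_hitchin_self[OF \<psi>])
    have "\<psi> [k (x + y), x + y, z] = \<psi> [k x, y, z] + \<psi> [k y, x, z]"
      by (simp add: linear_add[OF k] linear_add[OF lin] linear_add[OF lin2] self)
    then show ?thesis using self[of "x + y"] alt3_swaps(1)[OF \<psi>, of "k y" x z] by simp
  qed
  have lin: "linear (\<lambda>x. \<psi> [x, y, z])" for y z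
    using alt_form_linear[OF \<psi>, of "[0, y, z]" 0] by simp
  have lin2: "linear (\<lambda>y. \<psi> [x, y, z])" for x z
    using alt_form_linear[OF \<psi>, of "[x, 0, z]" 1] by simp
  show \<psi>J: "\<psi> [J x, y, z] = \<psi> [x, J y, z]" for x y z
    unfolding J_eq by (simp only: linear_scale[OF lin] linear_scale[OF lin2] k_sym)
  have h: "h x y = \<omega> [x, J y]" for x y by (simp add: h_def induced_metric_def J_def)
  have \<omega>J: "\<omega> [x, J y] = - \<omega> [J x, y]" for x y
    using h_sym[of x y] alt2_swap[OF \<omega>(1), of "J x" y] by (simp add: h)
  show skew: "h (J x) y = - h x (J y)" for x y by (simp add: h \<omega>J)
  have lin\<omega>: "linear (\<lambda>y. \<omega> [x, y])" for x
    using alt_form_linear[OF \<omega>(1), of "[x, 0]" 1] by simp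
  have inj: "x = 0" if "J x = 0" for x
    using h_eq_0_iff[of x] that linear_0[OF lin\<omega>] by (simp add: h)
  show nz: "\<psi> \<noteq> (\<lambda>_. 0)"
  proof
    assume "\<psi> = (\<lambda>_. 0)"
    then have "contract (k v) ?\<Omega> = (\<lambda>_. 0)" for v
      unfolding k_def vol.contract_hitchin[OF \<psi>] by (simp add: wedge_def contract_def fun_eq_iff)
    then have "k v = k 0" for v using vol.contract_inj by metis
    then have "k v = 0" for v using linear_0[OF k] by simp
    then show False using q by (simp add: q_def tr_def)
  qed
  obtain s where s: "\<And>x. J (J x) = s *\<^sub>R x"
    using skew_form_symmetric_square[OF dim \<psi> nz J skew inj \<psi>J] by metis
  have "card B = 6" using basis_finite_card(2)[of 5 B] dim orthonormal_independent[OF orthonormal] span_B by simp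
  then have "tr (\<lambda>x. J (J x)) = 6 * s" by (simp add: s tr_def h_basis)
  moreover have "tr (\<lambda>x. J (J x)) = (1 / r) * (1 / r) * (6 * q)"
    by (simp add: J_eq linear_scale[OF k] tr_def q_def sum_distrib_left sum_divide_distrib mult_ac linear_neg[OF k])
  ultimately have "s = - 1" using r q by (simp add: field_simps)
  then show JJ: "J (J x) = - x" for x using s by simp
  show "\<omega> [x, y] = h (J x) y" for x y
    using \<omega>J[of x "J y"] skew[of x y] by (simp add: h JJ linear_neg[OF lin\<omega>])
qed

section \<open>Curvature of metric Lie algebras\<close>

context orthonormal_frame
begin

lemma tr_diff: "tr (\<lambda>x. f x - g x) = tr f - tr g"
  by (simp add: tr_def sum_subtractf)

lemma tr_skew: assumes "\<And>x y. h (f x) y = - h x (f y)" shows "tr f = 0"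
proof -
  have "h (f x) x = 0" for x using assms[of x x] h_sym[of "f x" x] by simp
  then show ?thesis by (simp add: tr_def)
qed

end

locale metric_lie_algebra = orthonormal_frame h B
  for h :: "'a::real_vector \<Rightarrow> 'a \<Rightarrow> real" and B +
  fixes br :: "'a \<Rightarrow> 'a \<Rightarrow> 'a"
  assumes lie: "lie_bracket br"
begin

lemma bil_br: "bilinear br" and br_self: "br x x = 0"
  and jacobi: "br x (br y z) + br y (br z x) + br z (br x y) = 0"
  using lie by (auto simp: lie_bracket_def)

lemmas br_simps =
  bilinear_ladd[OF bil_br] bilinear_radd[OF bil_br] bilinear_lsub[OF bil_br] bilinear_rsub[OF bil_br]
  bilinear_lmul[OF bil_br] bilinear_rmul[OF bil_br] bilinear_lneg[OF bil_br] bilinear_rneg[OF bil_br]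

lemma br_linear: "linear (br x)" "linear (\<lambda>x. br x y)"
  using bil_br by (auto simp: bilinear_def)

lemma br_swap: "br y x = - br x y"
proof -
  have "br (x + y) (x + y) = br x x + br x y + (br y x + br y y)" by (simp add: br_simps)
  then have "br x y + br y x = 0" by (simp add: br_self)
  then show ?thesis by (simp add: eq_neg_iff_add_eq_0 add.commute)
qed

text \<open>The right-hand side of the Koszul formula for $h(\nabla_x y, z)$.\<close>

definition koszul :: "'a \<Rightarrow> 'a \<Rightarrow> 'a \<Rightarrow> real" where
  "koszul x y z = (h (br x y) z - h (br y z) x + h (br z x) y) / 2"

definition D :: "'a \<Rightarrow> 'a \<Rightarrow> 'a" where "D = levi_civita br h"

lemma levi_civita_unique:
  assumes "\<And>x y. E x y - E y x = br x y" "\<And>x y z. h (E x y) z + h y (E x z) = 0"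
  shows "h (E x y) z = koszul x y z"
proof -
  have skew: "h (E a b) c = - h (E a c) b" for a b c
    using assms(2)[of a b c] h_sym[of b "E a c"] by simp
  show ?thesis
    unfolding koszul_def assms(1)[symmetric]
    using skew[of x y z] skew[of y x z] skew[of z x y] by simp
qed

lemma levi_civita:
  shows bil_D: "bilinear D" and torsion_free: "D x y - D y x = br x y"
    and D_metric: "h (D x y) z + h y (D x z) = 0"
proof -
  define E where "E x y = (\<Sum>b\<in>B. koszul x y b *\<^sub>R b)" for x y
  have lin: "linear (\<lambda>z. koszul x y z)" for x y
    unfolding koszul_def by (rule linearI) (simp_all add: br_simps field_simps)
  have E: "h (E x y) z = koszul x y z" for x y z
    using linear_expand[OF lin, of x y z] by (simp add: E_def h_sum_left h_sym[of z] mult.commute)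
  have bilE: "bilinear E"
    unfolding bilinear_def
    by (intro conjI allI linearI eqI) (simp_all add: E koszul_def br_simps field_simps)
  have torE: "E x y - E y x = br x y" for x y
  proof (rule eqI)
    fix z
    show "h (E x y - E y x) z = h (br x y) z"
      by (simp add: E koszul_def br_swap[of x y] br_swap[of y z] br_swap[of z x] field_simps)
  qed
  have metE: "h (E x y) z + h y (E x z) = 0" for x y z
  proof -
    have "h y (E x z) = koszul x z y" using E[of x z y] h_sym[of y "E x z"] by simp
    then show ?thesis
      by (simp add: E koszul_def br_swap[of x y] br_swap[of y z] br_swap[of z x] field_simps)
  qed
  have "levi_civita br h = E"
    unfolding levi_civita_def
  proof (rule the_equality)
    show "bilinear E \<and> (\<forall>x y. E x y - E y x = br x y) \<and> (\<forall>x y z. h (E x y) z + h y (E x z) = 0)"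
      using bilE torE metE by blast
    fix F assume "bilinear F \<and> (\<forall>x y. F x y - F y x = br x y) \<and> (\<forall>x y z. h (F x y) z + h y (F x z) = 0)"
    then have "h (F x y) z = h (E x y) z" for x y z
      using levi_civita_unique[of F] E by simp
    then show "F = E" by (intro ext eqI)
  qed
  then show "bilinear D" "D x y - D y x = br x y" "h (D x y) z + h y (D x z) = 0"
    using bilE torE metE by (simp_all add: D_def)
qed

lemmas D_simps =
  bilinear_ladd[OF bil_D] bilinear_radd[OF bil_D] bilinear_lsub[OF bil_D] bilinear_rsub[OF bil_D]
  bilinear_lmul[OF bil_D] bilinear_rmul[OF bil_D] bilinear_lneg[OF bil_D] bilinear_rneg[OF bil_D]
  bilinear_lzero[OF bil_D] bilinear_rzero[OF bil_D]

lemma D_linear: "linear (D x)" "linear (\<lambda>x. D x y)"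
  using bil_D by (auto simp: bilinear_def)

lemma D_skew: "h (D x y) z = - h y (D x z)"
  using D_metric[of x y z] by simp

definition R :: "'a \<Rightarrow> 'a \<Rightarrow> 'a \<Rightarrow> 'a" where
  "R x y z = D x (D y z) - D y (D x z) - D (br x y) z"

lemma R_curvature: "curvature br h = R"
  by (simp add: fun_eq_iff curvature_def R_def D_def Let_def)

lemma R_linear: "linear (\<lambda>x. R x y z)"
  unfolding R_def by (auto intro!: linearI simp: D_simps br_simps algebra_simps)

lemma Ric_tr: "Ric br h y z = tr (\<lambda>x. R x y z)"
  unfolding Ric_def R_curvature by (rule tr_endo_trace[OF R_linear])

lemma tr_br_br: "tr (br (br x y)) = 0"
proof -
  have "br (br x y) z = br x (br y z) - br y (br x z)" for z
    using jacobi[of x y z] br_swap[of "br x y" z] br_swap[of z x] by (simp add: br_simps algebra_simps)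
  then have "br (br x y) = (\<lambda>z. br x (br y z) - br y (br x z))" by (rule ext)
  then have "tr (br (br x y)) = tr (\<lambda>z. br x (br y z)) - tr (\<lambda>z. br y (br x z))"
    by (simp only: tr_diff)
  then show ?thesis using tr_comm[OF br_linear(1) br_linear(1), of x y] by simp
qed

text \<open>Let $H$ be the mean curvature vector, $h(H, x) = \mathrm{tr}(\mathrm{ad}\, x)$. It is orthogonal
  to all brackets, hence $\nabla_H H = 0$ and $L = \nabla H$ is symmetric. Expanding the curvature
  gives $\mathrm{Ric}(H, H) = - \mathrm{tr} L^2$, which is negative because
  $\mathrm{tr} L = - |H|^2 \neq 0$.\<close>

theorem einstein_nonunimodular_negative:
  assumes "\<not> unimodular br" and Einstein: "\<And>y z. Ric br h y z = \<mu> * h y z"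
  shows "\<mu> < 0"
proof -
  define H where "H = (\<Sum>b\<in>B. tr (br b) *\<^sub>R b)"
  have "linear (\<lambda>x. tr (br x))"
    by (rule linearI) (simp_all add: tr_def br_simps sum.distrib sum_distrib_left)
  then have H: "h H x = tr (br x)" for x
    using linear_expand[of "\<lambda>x. tr (br x)" x] by (simp add: H_def h_sum_left h_sym[of x] mult.commute)
  have "H \<noteq> 0"
    using assms(1) H by (auto simp: unimodular_def tr_endo_trace[OF br_linear(1)])
  have Hbr: "h H (br x y) = 0" for x y by (simp add: H tr_br_br)
  define L where "L x = D x H" for x
  have L: "linear L" unfolding L_def by (rule D_linear)
  have L_sym: "h (L x) y = h x (L y)" for x y
  proof -
    have "h (L x) y - h (L y) x = - h H (D x y - D y x)" by (simp add: L_def D_skew)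
    then show ?thesis using Hbr[of x y] h_sym[of x "L y"] by (simp add: torsion_free)
  qed
  have DHH: "D H H = 0"
  proof (rule eqI)
    fix z
    have "D H z = br H z + L z" using torsion_free[of H z] by (simp add: L_def algebra_simps)
    moreover have "h H (L z) = 0" using D_skew[of z H H] h_sym[of H "L z"] by (simp add: L_def)
    ultimately show "h (D H H) z = h 0 z" using Hbr by (simp add: D_skew[of H H z])
  qed
  have "tr L = - h H H"
  proof -
    have "L x = D H x - br H x" for x using torsion_free[of x H] br_swap[of x H] by (simp add: L_def algebra_simps)
    then have "L = (\<lambda>x. D H x - br H x)" by blast
    then show ?thesis by (simp add: tr_diff H tr_skew D_skew)
  qed
  have "Ric br h H H = tr (\<lambda>x. - D H (L x) - L (L x) + L (D H x))"
  proof -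
    have "R x H H = - D H (L x) - L (L x - D H x)" for x
      using torsion_free[of x H] by (simp add: R_def DHH D_simps L_def)
    then show ?thesis by (simp add: Ric_tr linear_diff[OF L] diff_diff_eq2 diff_add_eq)
  qed
  also have "\<dots> = tr (\<lambda>x. L (D H x)) - tr (\<lambda>x. D H (L x)) - tr (\<lambda>x. L (L x))"
    by (simp add: tr_def sum.distrib sum_subtractf sum_negf)
  also have "\<dots> = - (\<Sum>b\<in>B. h (L b) (L b))"
    using tr_comm[OF L D_linear(1), of H] by (simp add: tr_def L_sym)
  finally have "\<mu> * h H H = - (\<Sum>b\<in>B. h (L b) (L b))" by (simp add: Einstein)
  moreover have "(\<Sum>b\<in>B. h (L b) (L b)) > 0"
  proof (rule ccontr)
    assume "\<not> ?thesis"
    then have "(\<Sum>b\<in>B. h (L b) (L b)) = 0" using sum_nonneg[of B "\<lambda>b. h (L b) (L b)"] h_nonneg by fastforce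
    then have "\<forall>b\<in>B. L b = 0" using sum_nonneg_eq_0_iff[OF fin, of "\<lambda>b. h (L b) (L b)"] h_nonneg h_eq_0_iff by auto
    then have "tr L = 0" by (simp add: tr_def)
    then show False using \<open>tr L = - h H H\<close> \<open>H \<noteq> 0\<close> h_eq_0_iff by simp
  qed
  ultimately have "\<mu> * h H H < 0" by simp
  then show ?thesis using h_pos[OF \<open>H \<noteq> 0\<close>] by (simp add: mult_less_0_iff)
qed

end

section \<open>Unitary frames adapted to a complex volume form\<close>

text \<open>A Hermitian structure with a 3-form of type $(3,0) + (0,3)$. The form is a function of three
  separate arguments, so that it can be rescaled and differentiated without reference to lists.\<close>

locale complex_volume = metric h
  for h :: "'a::real_vector \<Rightarrow> 'a \<Rightarrow> real" +
  fixes J :: "'a \<Rightarrow> 'a" and \<phi> :: "'a \<Rightarrow> 'a \<Rightarrow> 'a \<Rightarrow> real"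
  assumes J_linear: "linear J" and JJ: "J (J x) = - x" and J_skew: "h (J x) y = - h x (J y)"
    and \<phi>_linear: "linear (\<lambda>x. \<phi> x y z)" and \<phi>_swap: "\<phi> x y z = - \<phi> y x z" "\<phi> x y z = - \<phi> x z y"
    and \<phi>_J: "\<phi> (J x) y z = \<phi> x (J y) z"
begin

lemmas J_simps = linear_add[OF J_linear] linear_diff[OF J_linear] linear_scale[OF J_linear]
  linear_neg[OF J_linear] linear_0[OF J_linear]

lemma h_JJ: "h (J x) (J y) = h x y"
  by (simp add: J_skew JJ)

lemma h_J_self: "h x (J x) = 0" "h (J x) x = 0"
  using J_skew[of x x] h_sym[of "J x" x] by simp_all

lemma \<phi>_linear2: "linear (\<lambda>y. \<phi> x y z)" and \<phi>_linear3: "linear (\<lambda>z. \<phi> x y z)"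
proof -
  show *: "linear (\<lambda>y. \<phi> x y z)" for x z
    using linear_compose_neg[OF \<phi>_linear[of x z]] by (simp add: \<phi>_swap(1)[of x])
  show "linear (\<lambda>z. \<phi> x y z)"
    using linear_compose_neg[OF *[of x y]] by (simp add: \<phi>_swap(2)[of x y])
qed

lemmas \<phi>_simps =
  linear_add[OF \<phi>_linear] linear_diff[OF \<phi>_linear] linear_scale[OF \<phi>_linear] linear_neg[OF \<phi>_linear]
  linear_0[OF \<phi>_linear] linear_sum[OF \<phi>_linear]
  linear_add[OF \<phi>_linear2] linear_diff[OF \<phi>_linear2] linear_scale[OF \<phi>_linear2] linear_neg[OF \<phi>_linear2]
  linear_0[OF \<phi>_linear2] linear_sum[OF \<phi>_linear2]
  linear_add[OF \<phi>_linear3] linear_diff[OF \<phi>_linear3] linear_scale[OF \<phi>_linear3] linear_neg[OF \<phi>_linear3]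
  linear_0[OF \<phi>_linear3] linear_sum[OF \<phi>_linear3]

lemma \<phi>_rot: "\<phi> x y z = \<phi> y z x"
  using \<phi>_swap(1)[of x y z] \<phi>_swap(2)[of y x z] by simp

lemma \<phi>_J_front: "\<phi> x (J y) z = \<phi> (J x) y z" "\<phi> x y (J z) = \<phi> (J x) y z"
  using \<phi>_J[of x y z] \<phi>_J[of x z y] \<phi>_swap(2)[of x y "J z"] \<phi>_swap(2)[of "J x" y z] by simp_all

lemma \<phi>_repeat [simp]: "\<phi> x x z = 0" "\<phi> x y y = 0" "\<phi> x y x = 0"
  "\<phi> (J x) x z = 0" "\<phi> (J x) y x = 0"
proof -
  show a: "\<phi> x x z = 0" for x z using \<phi>_swap(1)[of x x z] by simp
  show b: "\<phi> x y y = 0" for x y using \<phi>_swap(2)[of x y y] by simp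
  show "\<phi> x y x = 0" using \<phi>_swap(2)[of x y x] a by simp
  show c: "\<phi> (J x) x z = 0" for z using \<phi>_J[of x x z] \<phi>_swap(1)[of x "J x" z] by simp
  show "\<phi> (J x) y x = 0" using \<phi>_swap(2)[of "J x" y x] c by simp
qed

lemma \<phi>_eq_0I:
  assumes span: "span B = UNIV" and 0: "\<And>x y z. x \<in> B \<Longrightarrow> y \<in> B \<Longrightarrow> z \<in> B \<Longrightarrow> \<phi> x y z = 0"
  shows "\<phi> x y z = 0"
proof -
  have 1: "\<phi> x y z = 0" if "y \<in> B" "z \<in> B" for x y z
    by (rule linear_eq_0_on_span[OF \<phi>_linear, of B]) (use 0 that span in auto)
  have 2: "\<phi> x y z = 0" if "z \<in> B" for x y z
    by (rule linear_eq_0_on_span[OF \<phi>_linear2, of B]) (use 1 that span in auto)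
  show ?thesis
    by (rule linear_eq_0_on_span[OF \<phi>_linear3, of B]) (use 2 span in auto)
qed

end

text \<open>A unitary frame in which \<open>\<phi>\<close> is the real part of the standard complex volume
  form.\<close>

locale su3_frame = complex_volume h J \<phi>
  for h :: "'a::real_vector \<Rightarrow> 'a \<Rightarrow> real" and J \<phi> +
  fixes u1 u2 u3 :: 'a
  assumes unit: "h u1 u1 = 1" "h u2 u2 = 1" "h u3 u3 = 1"
    and perp: "h u1 u2 = 0" "h u1 u3 = 0" "h u2 u3 = 0" "h u1 (J u2) = 0" "h u1 (J u3) = 0" "h u2 (J u3) = 0"
    and spanning: "span {u1, J u1, u2, J u2, u3, J u3} = UNIV"
    and \<phi>_frame: "\<phi> u1 u2 u3 = 1" "\<phi> (J u1) u2 u3 = 0"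
begin

abbreviation "frame \<equiv> {u1, J u1, u2, J u2, u3, J u3}"

lemma frame_inner [simp]:
  "h u1 u1 = 1" "h u2 u2 = 1" "h u3 u3 = 1"
  "h u1 u2 = 0" "h u1 u3 = 0" "h u2 u3 = 0" "h u2 u1 = 0" "h u3 u1 = 0" "h u3 u2 = 0"
  "h u1 (J u2) = 0" "h u1 (J u3) = 0" "h u2 (J u3) = 0" "h u2 (J u1) = 0" "h u3 (J u1) = 0" "h u3 (J u2) = 0"
  "h u1 (J u1) = 0" "h u2 (J u2) = 0" "h u3 (J u3) = 0"
  using unit perp h_sym[of u1 u2] h_sym[of u1 u3] h_sym[of u2 u3] h_sym[of u2 "J u1"] h_sym[of u3 "J u1"]
    h_sym[of u3 "J u2"] by (simp_all add: h_J_self J_skew)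

lemma distinct_frame: "distinct [u1, J u1, u2, J u2, u3, J u3]"
proof -
  have ne: "x \<noteq> y" if "h x x = 1" "h x y = 0" for x y using that by auto
  show ?thesis by (simp, intro conjI; rule ne; simp add: J_skew JJ)
qed

sublocale orthonormal_frame h frame
proof unfold_locales
  show "orthonormal h frame"
    unfolding orthonormal_def
  proof (intro conjI ballI)
    fix x y assume "x \<in> frame" "y \<in> frame"
    then have "x = y \<or> h x y = 0" "h x x = 1"
      by (elim insertE emptyE; simp add: J_skew JJ)+
    then show "h x y = (if x = y then 1 else 0)" by auto
  qed simp
qed (rule spanning)

lemma sum_frame: "(\<Sum>b\<in>frame. f b) = f u1 + f (J u1) + f u2 + f (J u2) + f u3 + f (J u3)"
  for f :: "'a \<Rightarrow> 'b::comm_monoid_add"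
  using distinct_frame by (simp add: add.assoc)

lemma \<phi>_frame_all [simp]:
  "\<phi> u1 u2 u3 = 1" "\<phi> u2 u3 u1 = 1" "\<phi> u3 u1 u2 = 1" "\<phi> u2 u1 u3 = -1" "\<phi> u3 u2 u1 = -1" "\<phi> u1 u3 u2 = -1"
  "\<phi> (J u1) u2 u3 = 0" "\<phi> (J u2) u3 u1 = 0" "\<phi> (J u3) u1 u2 = 0"
  "\<phi> (J u2) u1 u3 = 0" "\<phi> (J u3) u2 u1 = 0" "\<phi> (J u1) u3 u2 = 0"
proof -
  note sw = \<phi>_swap(1)[of u2 u1 u3] \<phi>_swap(2)[of u1 u3 u2] \<phi>_rot[of u1 u2 u3] \<phi>_rot[of u3 u1 u2]
    \<phi>_swap(2)[of u3 u2 u1]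
  show "\<phi> u1 u2 u3 = 1" "\<phi> u2 u3 u1 = 1" "\<phi> u3 u1 u2 = 1" "\<phi> u2 u1 u3 = -1" "\<phi> u3 u2 u1 = -1" "\<phi> u1 u3 u2 = -1"
    using sw \<phi>_frame by simp_all
  show 1: "\<phi> (J u1) u2 u3 = 0" by (rule \<phi>_frame)
  show 2: "\<phi> (J u2) u3 u1 = 0" using \<phi>_rot[of u1 "J u2" u3] \<phi>_J[of u1 u2 u3] 1 by simp
  show 3: "\<phi> (J u3) u1 u2 = 0" using \<phi>_rot[of "J u3" u1 u2] \<phi>_J_front(2)[of u1 u2 u3] 1 by simp
  show "\<phi> (J u2) u1 u3 = 0" "\<phi> (J u3) u2 u1 = 0" "\<phi> (J u1) u3 u2 = 0"
    using 1 2 3 \<phi>_swap(2)[of "J u2" u1 u3] \<phi>_swap(2)[of "J u3" u2 u1] \<phi>_swap(2)[of "J u1" u3 u2] by simp_all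
qed

text \<open>In a frame, \<open>\<phi>\<close> is the triple product of a cross product with
  $u_1 \times u_2 = u_3$ and its cyclic images.\<close>

lemma \<phi>_cross [simp]:
  "\<phi> v u2 u3 = h v u1" "\<phi> v u3 u1 = h v u2" "\<phi> v u1 u2 = h v u3"
  "\<phi> v u3 u2 = - h v u1" "\<phi> v u1 u3 = - h v u2" "\<phi> v u2 u1 = - h v u3"
proof -
  have eq: "\<phi> v x y = h v z" if "\<And>b. b \<in> frame \<Longrightarrow> \<phi> b x y = h b z" for x y z
    using linear_eq_on[OF \<phi>_linear h_linear_left, of v frame x y z] that spanning by simp
  show 1: "\<phi> v u2 u3 = h v u1" "\<phi> v u3 u1 = h v u2" "\<phi> v u1 u2 = h v u3"
    by (rule eq; elim insertE emptyE; simp add: J_skew)+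
  show "\<phi> v u3 u2 = - h v u1" "\<phi> v u1 u3 = - h v u2" "\<phi> v u2 u1 = - h v u3"
    using \<phi>_swap(2)[of v u3 u2] \<phi>_swap(2)[of v u1 u3] \<phi>_swap(2)[of v u2 u1] 1 by simp_all
qed

lemma \<phi>_nondegenerate: assumes "\<And>y z. \<phi> v y z = 0" shows "v = 0"
proof (rule eq_on_basis)
  have *: "h v u1 = 0" "h v u2 = 0" "h v u3 = 0" "h (J v) u1 = 0" "h (J v) u2 = 0" "h (J v) u3 = 0"
    using assms \<phi>_J[of v u2 u3] \<phi>_J[of v u3 u1] \<phi>_J[of v u1 u2] by (simp_all flip: \<phi>_cross(1-3))
  fix b assume "b \<in> frame"
  then show "h v b = h 0 b" using * by (auto simp: J_skew)
qed

lemma rotate: "su3_frame h J \<phi> u2 u3 u1"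
  by unfold_locales (use spanning in \<open>simp_all add: insert_commute J_skew\<close>)

text \<open>Rotating the second and the third vector by opposite right angles, and likewise the first and the
  second, keeps the value of \<open>\<phi>\<close>. Comparing the same equation in the old and the
  new frame separates its terms.\<close>

lemma turn: "su3_frame h J \<phi> u1 (J u2) (- J u3)"
proof unfold_locales
  have "frame \<subseteq> span {u1, J u1, J u2, J (J u2), - J u3, J (- J u3)}"
  proof -
    have "u2 \<in> span {J (J u2)}" "J u3 \<in> span {- J u3}"
      using span_neg[OF span_base[of "J (J u2)" "{J (J u2)}"]] span_neg[OF span_base[of "- J u3" "{- J u3}"]] by (simp_all add: JJ)
    then have "u2 \<in> span {u1, J u1, J u2, J (J u2), - J u3, J (- J u3)}"
      "J u3 \<in> span {u1, J u1, J u2, J (J u2), - J u3, J (- J u3)}"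
      by (meson span_mono subsetD empty_subsetI insert_subset insertI1 insertI2)+
    moreover have "J (- J u3) = u3" by (simp add: J_simps JJ)
    ultimately show ?thesis by (simp add: span_base)
  qed
  then have "UNIV \<subseteq> span {u1, J u1, J u2, J (J u2), - J u3, J (- J u3)}"
    using span_minimal[OF _ subspace_span] spanning by metis
  then show "span {u1, J u1, J u2, J (J u2), - J u3, J (- J u3)} = UNIV" by blast
qed (simp_all add: J_skew JJ J_simps \<phi>_J_front \<phi>_simps)

lemma turn': "su3_frame h J \<phi> (J u1) (- J u2) u3"
  using su3_frame.rotate[OF su3_frame.turn[OF su3_frame.rotate[OF rotate]]] by simp

text \<open>A 2-form of type $(2,0) + (0,2)$ has three complex components, its values on the pairs from
  \<open>u1\<close>, \<open>u2\<close>, \<open>u3\<close>, and contracting \<open>\<phi>\<close>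
  with a vector realises any three complex numbers.\<close>

lemma type_2_0_form:
  assumes lin: "\<And>z. linear (\<lambda>y. g y z)" and skew: "\<And>y z. g y z = - g z y" and J: "\<And>y z. g (J y) z = g y (J z)"
  defines "t \<equiv> g u2 u3 *\<^sub>R u1 - g (J u2) u3 *\<^sub>R J u1 + g u3 u1 *\<^sub>R u2 - g (J u3) u1 *\<^sub>R J u2
    + g u1 u2 *\<^sub>R u3 - g (J u1) u2 *\<^sub>R J u3"
  shows "g y z = \<phi> t y z"
proof -
  have gJJ: "g (- y) z = - g y z" for y z by (rule linear_neg[OF lin])
  have gJ: "g y (J z) = g (J y) z" for y z by (simp add: J)
  have g0: "g y y = 0" "g (J y) y = 0" for y
  proof -
    show "g y y = 0" using skew[of y y] by simp
    show "g (J y) y = 0" using skew[of "J y" y] J[of y y] by simp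
  qed
  have flip: "g u3 u2 = - g u2 u3" "g u1 u3 = - g u3 u1" "g u2 u1 = - g u1 u2"
    "g (J u3) u2 = - g (J u2) u3" "g (J u1) u3 = - g (J u3) u1" "g (J u2) u1 = - g (J u1) u2"
    using skew[of u3 u2] skew[of u1 u3] skew[of u2 u1] skew[of "J u3" u2] skew[of "J u1" u3] skew[of "J u2" u1]
    by (simp_all add: gJ)
  have t: "h t u1 = g u2 u3" "h t u2 = g u3 u1" "h t u3 = g u1 u2"
    "h t (J u1) = - g (J u2) u3" "h t (J u2) = - g (J u3) u1" "h t (J u3) = - g (J u1) u2"
    unfolding t_def by (simp_all add: J_skew JJ)
  have basis: "g y z = \<phi> t y z" if "y \<in> frame" "z \<in> frame" for y z
    using that
    by (elim insertE emptyE; simp add: gJJ gJ g0 flip \<phi>_J_front JJ J_skew t linear_neg[OF \<phi>_linear])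
  have lin2: "linear (\<lambda>z. g y z)" for y
    using linear_compose_neg[OF lin[of y]] by (simp add: skew[of y])
  have half: "g y z = \<phi> t y z" if "z \<in> frame" for y z
    using linear_eq_on[OF lin \<phi>_linear2, of y frame z t z] basis that spanning by simp
  show ?thesis using linear_eq_on[OF lin2 \<phi>_linear3, of z frame y t y] half spanning by simp
qed

end

text \<open>Take an eigenframe of \<open>A\<close>. The complex number $p - iq$ formed below is the value of the complex
  volume form on it; rotating the third vector in its plane, which stays an eigenplane of \<open>A\<close>, makes
  this number real, and dividing by its modulus $r$ normalises it.\<close>

lemma (in complex_volume) adapted_frame_exists:
  assumes dim: "dim (UNIV :: 'a set) = 6" and nonzero: "\<exists>x y z. \<phi> x y z \<noteq> 0"
    and A: "linear A" "\<And>x y. h (A x) y = h x (A y)" "\<And>x. A (J x) = J (A x)"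
  obtains r u1 u2 u3 s1 s2 s3 where "r \<noteq> 0" "su3_frame h J (\<lambda>x y z. \<phi> x y z / r) u1 u2 u3"
    "A u1 = s1 *\<^sub>R u1" "A u2 = s2 *\<^sub>R u2" "A u3 = s3 *\<^sub>R u3"
proof -
  have inj: "x = 0" if "J x = 0" for x using JJ[of x] that by (simp add: J_simps)
  have JJ': "\<exists>k. J (J u) = k *\<^sub>R u" for u using JJ[of u] by (intro exI[of _ "- 1"]) simp
  obtain u1 u2 u3 s1 s2 s3 where u: "A u1 = s1 *\<^sub>R u1" "A u2 = s2 *\<^sub>R u2" "A u3 = s3 *\<^sub>R u3"
      and unit: "h u1 u1 = 1" "h u2 u2 = 1" "h u3 u3 = 1"
      and perp: "h u1 u2 = 0" "h u1 u3 = 0" "h u2 u3 = 0" "h u1 (J u2) = 0" "h u1 (J u3) = 0" "h u2 (J u3) = 0"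
      and span: "span {u1, J u1, u2, J u2, u3, J u3} = UNIV"
    by (rule skew_invariant_eigenframe[OF dim J_linear J_skew inj A JJ'])
  define p q where "p = \<phi> u1 u2 u3" and "q = \<phi> (J u1) u2 u3"
  have "p \<noteq> 0 \<or> q \<noteq> 0"
  proof (rule ccontr)
    assume "\<not> (p \<noteq> 0 \<or> q \<noteq> 0)"
    then have *: "\<phi> u1 u2 u3 = 0" "\<phi> (J u1) u2 u3 = 0" by (simp_all add: p_def q_def)
    have all: "\<phi> x y z = 0 \<and> \<phi> y z x = 0 \<and> \<phi> z x y = 0 \<and> \<phi> y x z = 0 \<and> \<phi> x z y = 0 \<and> \<phi> z y x = 0"
      if "\<phi> x y z = 0" for x y z
      using that \<phi>_rot[of x y z] \<phi>_rot[of y z x] \<phi>_swap[of y x z] \<phi>_swap(2)[of x z y] \<phi>_rot[of z y x]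
        \<phi>_rot[of y x z] by simp
    have J1: "\<phi> (J u2) u3 u1 = 0" "\<phi> (J u3) u1 u2 = 0"
      using all[OF *(2)] \<phi>_J_front[of u1 u2 u3] \<phi>_rot[of u1 "J u2" u3] \<phi>_rot[of "J u3" u1 u2] by simp_all
    have "\<phi> x y z = 0" for x y z
    proof (rule \<phi>_eq_0I[OF span])
      fix x y z assume "x \<in> {u1, J u1, u2, J u2, u3, J u3}" "y \<in> {u1, J u1, u2, J u2, u3, J u3}"
        "z \<in> {u1, J u1, u2, J u2, u3, J u3}"
      then show "\<phi> x y z = 0"
        by (elim insertE emptyE; simp add: \<phi>_J_front JJ linear_neg[OF \<phi>_linear] J_simps
          all[OF *(1)] all[OF *(2)] all[OF J1(1)] all[OF J1(2)])
    qed
    then show False using nonzero by blast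
  qed
  then have pos: "p\<^sup>2 + q\<^sup>2 > 0" by (simp add: sum_power2_gt_zero_iff)
  define r where "r = sqrt (p\<^sup>2 + q\<^sup>2)"
  have r: "r > 0" "r * r = p\<^sup>2 + q\<^sup>2" using pos by (auto simp: r_def)
  define a b where "a = p / r" and "b = q / r"
  have ab: "a\<^sup>2 + b\<^sup>2 = 1" "a * p + b * q = r" "a * q - b * p = 0"
  proof -
    have "a\<^sup>2 + b\<^sup>2 = (p\<^sup>2 + q\<^sup>2) / (r * r)"
      by (simp add: a_def b_def power_divide add_divide_distrib power2_eq_square)
    then show "a\<^sup>2 + b\<^sup>2 = 1" by (simp only: r(2) divide_self[OF less_imp_neq[OF pos, symmetric]])
    have "a * p + b * q = (p\<^sup>2 + q\<^sup>2) / r"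
      by (simp add: a_def b_def add_divide_distrib power2_eq_square)
    then show "a * p + b * q = r" unfolding r(2)[symmetric] using r(1) by simp
    show "a * q - b * p = 0" by (simp add: a_def b_def)
  qed
  define v3 where "v3 = a *\<^sub>R u3 + b *\<^sub>R J u3"
  have Jv3: "J v3 = a *\<^sub>R J u3 - b *\<^sub>R u3" by (simp add: v3_def J_simps JJ)
  have frame: "su3_frame h J (\<lambda>x y z. \<phi> x y z / r) u1 u2 v3"
  proof (intro su3_frame.intro complex_volume.intro complex_volume_axioms.intro su3_frame_axioms.intro
      metric_axioms J_linear JJ J_skew unit perp)
    show "linear (\<lambda>x. \<phi> x y z / r)" for y z
      using linear_real_mult[OF \<phi>_linear, of "1 / r" y z] by simp
    show "\<phi> x y z / r = - (\<phi> y x z / r)" "\<phi> x y z / r = - (\<phi> x z y / r)" for x y z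
      using \<phi>_swap[of x y z] by (simp_all only: minus_divide_left)
    show "\<phi> (J x) y z / r = \<phi> x (J y) z / r" for x y z by (simp add: \<phi>_J)
    show "h v3 v3 = 1"
      using ab(1) unit by (simp add: v3_def J_skew JJ h_J_self power2_eq_square)
    have "u3 \<in> span {v3, J v3}" "J u3 \<in> span {v3, J v3}"
    proof -
      have "a *\<^sub>R v3 - b *\<^sub>R J v3 = (a\<^sup>2 + b\<^sup>2) *\<^sub>R u3" "b *\<^sub>R v3 + a *\<^sub>R J v3 = (a\<^sup>2 + b\<^sup>2) *\<^sub>R J u3"
        unfolding Jv3 unfolding v3_def by (simp_all add: algebra_simps power2_eq_square)
      then have "u3 = a *\<^sub>R v3 - b *\<^sub>R J v3" "J u3 = b *\<^sub>R v3 + a *\<^sub>R J v3"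
        by (simp_all add: ab(1))
      then show "u3 \<in> span {v3, J v3}" "J u3 \<in> span {v3, J v3}"
        by (metis insertI1 insertI2 span_add span_base span_diff span_scale)+
    qed
    then have "u3 \<in> span {u1, J u1, u2, J u2, v3, J v3}" "J u3 \<in> span {u1, J u1, u2, J u2, v3, J v3}"
      using span_mono[of "{v3, J v3}" "{u1, J u1, u2, J u2, v3, J v3}"] by blast+
    then have "{u1, J u1, u2, J u2, u3, J u3} \<subseteq> span {u1, J u1, u2, J u2, v3, J v3}"
      by (simp add: span_base)
    from span_minimal[OF this subspace_span] have "UNIV \<subseteq> span {u1, J u1, u2, J u2, v3, J v3}"
      by (simp only: span)
    then show "span {u1, J u1, u2, J u2, v3, J v3} = UNIV" by blast
    show "\<phi> u1 u2 v3 / r = 1" "\<phi> (J u1) u2 v3 / r = 0"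
      using ab(2,3) r(1) unfolding p_def q_def
      by (simp_all add: v3_def \<phi>_simps \<phi>_J_front JJ)
    show "h u1 v3 = 0" "h u2 v3 = 0" "h u1 (J v3) = 0" "h u2 (J v3) = 0"
      unfolding Jv3 unfolding v3_def using perp by simp_all
  qed
  show ?thesis
  proof (rule that[OF _ frame u(1,2)])
    show "r \<noteq> 0" using r(1) by simp
    show "A v3 = s3 *\<^sub>R v3"
      by (simp add: v3_def linear_add[OF A(1)] linear_scale[OF A(1)] A(3) u(3) J_simps scaleR_add_right
          mult.commute)
  qed
qed

section \<open>The torsion of a coupled structure\<close>

context su3_frame
begin

lemma \<phi>_cross_positions [simp]:
  "\<phi> u1 u2 v = h v u3" "\<phi> (J u1) u2 v = h (J v) u3"
  "\<phi> u1 v u2 = - h v u3" "\<phi> (J u1) v u2 = - h (J v) u3"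
  "\<phi> u2 u3 v = h v u1" "\<phi> (J u2) u3 v = h (J v) u1"
  "\<phi> u2 v u3 = - h v u1" "\<phi> (J u2) v u3 = - h (J v) u1"
  "\<phi> u3 u1 v = h v u2" "\<phi> (J u3) u1 v = h (J v) u2"
  "\<phi> u3 v u1 = - h v u2" "\<phi> (J u3) v u1 = - h (J v) u2"
  "\<phi> u2 u1 v = - h v u3" "\<phi> (J u2) u1 v = - h (J v) u3"
  "\<phi> u2 v u1 = h v u3" "\<phi> (J u2) v u1 = h (J v) u3"
  "\<phi> u3 u2 v = - h v u1" "\<phi> (J u3) u2 v = - h (J v) u1"
  "\<phi> u3 v u2 = h v u1" "\<phi> (J u3) v u2 = h (J v) u1"
  "\<phi> u1 u3 v = - h v u2" "\<phi> (J u1) u3 v = - h (J v) u2"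
  "\<phi> u1 v u3 = h v u2" "\<phi> (J u1) v u3 = h (J v) u2"
proof -
  have last: "\<phi> (J x) y v = \<phi> (J v) x y" for x y using \<phi>_rot[of v x "J y"] \<phi>_rot[of x "J y" v] \<phi>_J_front[of x y v] \<phi>_J_front(2)[of v x y] by simp
  have mid: "\<phi> x v y = - \<phi> v x y" "\<phi> (J x) v y = - \<phi> (J v) x y" for x y
    using \<phi>_swap(1)[of x v y] \<phi>_swap(1)[of x "J v" y] \<phi>_J_front(1)[of x v y] by simp_all
  show "\<phi> u1 u2 v = h v u3" "\<phi> (J u1) u2 v = h (J v) u3"
    "\<phi> u1 v u2 = - h v u3" "\<phi> (J u1) v u2 = - h (J v) u3"
    "\<phi> u2 u3 v = h v u1" "\<phi> (J u2) u3 v = h (J v) u1"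
    "\<phi> u2 v u3 = - h v u1" "\<phi> (J u2) v u3 = - h (J v) u1"
    "\<phi> u3 u1 v = h v u2" "\<phi> (J u3) u1 v = h (J v) u2"
    "\<phi> u3 v u1 = - h v u2" "\<phi> (J u3) v u1 = - h (J v) u2"
    "\<phi> u2 u1 v = - h v u3" "\<phi> (J u2) u1 v = - h (J v) u3"
    "\<phi> u2 v u1 = h v u3" "\<phi> (J u2) v u1 = h (J v) u3"
    "\<phi> u3 u2 v = - h v u1" "\<phi> (J u3) u2 v = - h (J v) u1"
    "\<phi> u3 v u2 = h v u1" "\<phi> (J u3) v u2 = h (J v) u1"
    "\<phi> u1 u3 v = - h v u2" "\<phi> (J u1) u3 v = - h (J v) u2"
    "\<phi> u1 v u3 = h v u2" "\<phi> (J u1) v u3 = h (J v) u2"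
    by (simp_all add: \<phi>_rot[of _ _ v] last mid \<phi>_J_front)
qed

end

locale su3_lie_algebra =
  su3_frame h J \<phi> u1 u2 u3 + metric_lie_algebra h "{u1, J u1, u2, J u2, u3, J u3}" br
  for h :: "'a::real_vector \<Rightarrow> 'a \<Rightarrow> real" and J \<phi> u1 u2 u3 and br :: "'a \<Rightarrow> 'a \<Rightarrow> 'a"
begin

text \<open>The covariant derivative of \<open>J\<close>.\<close>

definition N :: "'a \<Rightarrow> 'a \<Rightarrow> 'a" where
  "N x y = D x (J y) - J (D x y)"

lemma D_J: "D x (J y) = J (D x y) + N x y"
  by (simp add: N_def)

lemma N_linear: "linear (\<lambda>x. N x y)" "linear (N x)"
  by (auto intro!: linearI simp: N_def D_simps J_simps algebra_simps)

lemma N_skew: "h (N x y) z = - h (N x z) y"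
  using D_skew[of x "J y" z] D_skew[of x y "J z"] h_sym[of "D x z" "J y"] h_sym[of "D x (J z)" y]
    h_sym[of "J (D x z)" y] h_sym[of "D x z" y]
  by (simp add: N_def J_skew JJ)

lemma N_J: "h (N x (J y)) z = h (N x y) (J z)"
  by (simp add: N_def J_skew JJ D_simps)

text \<open>The derivative of \<open>J\<close> anticommutes with \<open>J\<close> and is skew; so it is given
  by a 2-form of type $(2,0) + (0,2)$, which is the contraction of \<open>\<phi>\<close> with a
  vector. This endomorphism \<open>T\<close> is the torsion of the structure.\<close>

lemma torsion_exists: "\<exists>T. linear T \<and> (\<forall>x y z. h (N x y) z = \<phi> (T x) y z)"
proof -
  define T where "T x = h (N x u2) u3 *\<^sub>R u1 - h (N x (J u2)) u3 *\<^sub>R J u1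
    + h (N x u3) u1 *\<^sub>R u2 - h (N x (J u3)) u1 *\<^sub>R J u2
    + h (N x u1) u2 *\<^sub>R u3 - h (N x (J u1)) u2 *\<^sub>R J u3" for x
  have "h (N x y) z = \<phi> (T x) y z" for x y z
    unfolding T_def
    by (rule type_2_0_form[of "\<lambda>y z. h (N x y) z"])
      (auto intro!: linearI simp: linear_add[OF N_linear(2)] linear_scale[OF N_linear(2)] N_J intro: N_skew)
  moreover have "linear T"
    unfolding T_def
    by (rule linearI) (simp_all add: linear_add[OF N_linear(1)] linear_scale[OF N_linear(1)] algebra_simps)
  ultimately show ?thesis by blast
qed

end

locale su3_torsion = su3_lie_algebra h J \<phi> u1 u2 u3 br
  for h :: "'a::real_vector \<Rightarrow> 'a \<Rightarrow> real" and J \<phi> u1 u2 u3 and br :: "'a \<Rightarrow> 'a \<Rightarrow> 'a" +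
  fixes T :: "'a \<Rightarrow> 'a"
  assumes T_linear: "linear T" and N_torsion: "h (N x y) z = \<phi> (T x) y z"
begin

lemmas T_simps = linear_add[OF T_linear] linear_diff[OF T_linear] linear_scale[OF T_linear]
  linear_neg[OF T_linear] linear_0[OF T_linear] linear_sum[OF T_linear]

text \<open>The assumption is $d\omega = c \, \phi$. Inserting $y$ and $Jy$ leaves $\phi(Cy, x, y) = 0$ for
  the part $C$ of $T$ that does not commute with $J$. This part is conjugate linear, so polarising
  and replacing $z$ by $Jz$ gives two equations whose sum says $\phi(JCy, x, z) = 0$ for all $x$
  and $z$.\<close>

lemma torsion_commutes:
  assumes d\<omega>: "\<And>x y z. h (N x y) z + h (N y z) x + h (N z x) y = c * \<phi> x y z"
  shows "T (J x) = J (T x)"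
proof -
  define C where "C x = T (J x) - J (T x)" for x
  have C_linear: "linear C" unfolding C_def
    by (rule linearI) (simp_all add: T_simps J_simps algebra_simps)
  have CJ: "C (J x) = - J (C x)" for x by (simp add: C_def T_simps J_simps JJ)
  have C0: "\<phi> (C y) x y = 0" for x y
    using d\<omega>[of x y "J y"] \<phi>_swap(2)[of "J (T y)" y x]
    by (simp add: N_torsion C_def \<phi>_J_front \<phi>_simps)
  have pol: "\<phi> (C y) x z + \<phi> (C z) x y = 0" for x y z
    using C0[of "y + z" x] C0[of y x] C0[of z x] by (simp add: linear_add[OF C_linear] \<phi>_simps)
  have "\<phi> (J (C y)) x z = 0" for x y z
    using pol[of y "J x" z] pol[of y x "J z"] by (simp add: CJ \<phi>_J_front \<phi>_simps)
  then have "J (C x) = 0" by (intro \<phi>_nondegenerate)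
  then have "J (J (C x)) = 0" by (simp add: J_simps)
  then show ?thesis by (simp add: JJ C_def)
qed

lemma D_\<phi>_self: "\<phi> (D x y) (J y) w + \<phi> y (D x (J y)) w + \<phi> y (J y) (D x w) = - \<phi> (N x y) y w"
  using \<phi>_swap(1)[of y "J (D x y)" w] \<phi>_swap(1)[of y "N x y" w]
  by (simp add: D_J \<phi>_J_front \<phi>_simps)

end

text \<open>The last assumption is $d\phi = 0$, written with the torsion-free connection.\<close>

locale su3_closed = su3_torsion h J \<phi> u1 u2 u3 br T
  for h :: "'a::real_vector \<Rightarrow> 'a \<Rightarrow> real" and J \<phi> u1 u2 u3 and br :: "'a \<Rightarrow> 'a \<Rightarrow> 'a" and T +
  assumes TJ: "T (J x) = J (T x)"
    and closed: "\<phi> (D x y) z w + \<phi> y (D x z) w + \<phi> y z (D x w)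
      - (\<phi> (D y x) z w + \<phi> x (D y z) w + \<phi> x z (D y w))
      + (\<phi> (D z x) y w + \<phi> x (D z y) w + \<phi> x y (D z w))
      - (\<phi> (D w x) y z + \<phi> x (D w y) z + \<phi> x y (D w z)) = 0"
begin

lemma D_self0: "h (D x y) y = 0"
  using D_skew[of x y y] h_sym[of "D x y" y] by simp

lemma tr_JD: "tr (\<lambda>y. J (D x y)) = 2 * (h (J (D x u1)) u1 + h (J (D x u2)) u2 + h (J (D x u3)) u3)"
proof -
  have "h (J (D x (J b))) (J b) = h (J (D x b)) b" for b
    using J_skew[of b "D x b"] h_sym[of b "J (D x b)"] by (simp only: h_JJ D_skew[of x "J b" b])
  then show ?thesis by (simp add: tr_def sum_frame)
qed

text \<open>The equation $d\phi = 0$ evaluated on \<open>u1\<close>, \<open>J u1\<close>, \<open>u2\<close>,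
  \<open>u3\<close>.\<close>

lemma frame_equation: "tr (\<lambda>y. J (D u1 y)) / 2 + h (T u2) u3 - h (T u3) u2 = 0"
proof -
  have 1: "\<phi> (D u1 (J u1)) u2 u3 + \<phi> (J u1) (D u1 u2) u3 + \<phi> (J u1) u2 (D u1 u3)
      = tr (\<lambda>y. J (D u1 y)) / 2"
  proof -
    have "h (D u1 (J u1)) u1 = - h (D u1 u1) (J u1)"
      using D_skew[of u1 "J u1" u1] h_sym[of "J u1" "D u1 u1"] by (rule trans[OF _ arg_cong])
    then show ?thesis by (simp add: tr_JD J_skew)
  qed
  have 2: "\<phi> (D (J u1) u1) u2 u3 + \<phi> u1 (D (J u1) u2) u3 + \<phi> u1 u2 (D (J u1) u3) = 0"
    by (simp add: D_self0)
  have N: "\<phi> (N x u1) u1 u3 = - h (T x) u3" "\<phi> (N x u1) u1 u2 = - h (T x) u2" for x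
    by (simp_all add: N_torsion)
  show ?thesis
    using closed[of u1 "J u1" u2 u3] D_\<phi>_self[of u2 u1 u3] D_\<phi>_self[of u3 u1 u2]
    unfolding 1 2 N by simp
qed

lemma frame_equation_same:
  "h (T u1) (J u1) + h (T u2) (J u2) = 0"
  using closed[of u1 "J u1" u2 "J u2"]
  by (simp add: D_J \<phi>_simps \<phi>_J_front JJ J_simps J_skew N_torsion TJ)

text \<open>Torsion and connection do not depend on the frame, so the equations proved in one frame hold in
  every other one.\<close>

lemma change_frame:
  assumes "su3_frame h J \<phi> v1 v2 v3" shows "su3_closed h J \<phi> v1 v2 v3 br T"
proof -
  interpret v: su3_frame h J \<phi> v1 v2 v3 by fact
  interpret w: metric_lie_algebra h "{v1, J v1, v2, J v2, v3, J v3}" br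
    by unfold_locales (rule lie)
  interpret v: su3_lie_algebra h J \<phi> v1 v2 v3 br by unfold_locales
  have "su3_torsion h J \<phi> v1 v2 v3 br T"
    by (intro su3_torsion.intro su3_torsion_axioms.intro v.su3_lie_algebra_axioms T_linear) (rule N_torsion)
  then show ?thesis
    by (rule su3_closed.intro) (rule su3_closed_axioms.intro, rule TJ, rule closed)
qed

text \<open>The trace is taken without reference to the frame, to compare its values across frames.\<close>

definition trJ :: "'a \<Rightarrow> real" where "trJ x = endo_trace (\<lambda>y. J (D x y))"

lemma trJ_tr: "trJ x = tr (\<lambda>y. J (D x y))"
  unfolding trJ_def using linear_compose[OF D_linear(1) J_linear, of x]
  by (intro tr_endo_trace) (simp add: o_def)

lemma frame_consequence: "trJ u1 = 0" "h (T u2) u3 = h (T u3) u2"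
proof -
  interpret t: su3_closed h J \<phi> u1 "J u2" "- J u3" br T by (rule change_frame[OF turn])
  have "trJ u1 / 2 + h (T u2) u3 - h (T u3) u2 = 0" using frame_equation by (simp add: trJ_tr)
  moreover have "trJ u1 / 2 - h (T u2) u3 + h (T u3) u2 = 0"
    using t.frame_equation by (simp add: t.trJ_tr T_simps TJ h_JJ)
  ultimately show "trJ u1 = 0" "h (T u2) u3 = h (T u3) u2" by linarith+
qed

lemma frame_consequence_J: "trJ (J u1) = 0" "h (T (J u2)) u3 = h (T u3) (J u2)"
proof -
  interpret t: su3_closed h J \<phi> "J u1" "- J u2" u3 br T by (rule change_frame[OF turn'])
  show "trJ (J u1) = 0" by (rule t.frame_consequence)
  show "h (T (J u2)) u3 = h (T u3) (J u2)" using t.frame_consequence(2) by (simp add: T_simps)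
qed

text \<open>The two preceding lemmas and \<open>frame_equation_same\<close>, for the given frame and its
  cyclic rotations, cover all pairs of frame vectors.\<close>

lemma T_symmetric: "h (T x) y = h x (T y)" and trJ_eq_0: "trJ x = 0"
proof -
  interpret r: su3_closed h J \<phi> u2 u3 u1 br T by (rule change_frame[OF rotate])
  interpret s: su3_closed h J \<phi> u3 u1 u2 br T by (rule change_frame[OF r.rotate])
  have "linear trJ" unfolding trJ_tr tr_def
    by (rule linearI) (simp_all add: D_simps J_simps sum.distrib sum_distrib_left)
  moreover have "trJ b = 0" if "b \<in> frame" for b
    using that frame_consequence(1) r.frame_consequence(1) s.frame_consequence(1)
      frame_consequence_J(1) r.frame_consequence_J(1) s.frame_consequence_J(1) by blast
  ultimately show "trJ x = 0" using linear_eq_0_on_span[of trJ frame x] spanning by auto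
  have diag: "h (T u1) (J u1) = 0" "h (T u2) (J u2) = 0" "h (T u3) (J u3) = 0"
    using frame_equation_same r.frame_equation_same s.frame_equation_same by linarith+
  note off = frame_consequence(2) r.frame_consequence(2) s.frame_consequence(2)
    frame_consequence_J(2) r.frame_consequence_J(2) s.frame_consequence_J(2)
  have swapJ: "h (J (T a)) b = - h (T a) (J b)" for a b by (rule J_skew)
  have basis: "h (T x) y = h (T y) x" if "x \<in> frame" "y \<in> frame" for x y
    using that
    by (elim insertE emptyE; use off in \<open>simp add: TJ swapJ JJ diag\<close>)
  have half: "h (T x) y = h (T y) x" if "y \<in> frame" for x y
  proof -
    have "linear (\<lambda>x. h (T x) y)" by (rule linearI) (simp_all add: T_simps)
    from linear_eq_on[OF this h_linear_right, of x frame "T y"] show ?thesis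
      using basis that spanning by simp
  qed
  have "linear (\<lambda>y. h (T y) x)" by (rule linearI) (simp_all add: T_simps)
  from linear_eq_on[OF h_linear_right this, of y frame "T x"] have "h (T x) y = h (T y) x"
    using half spanning by simp
  then show "h (T x) y = h x (T y)" using h_sym[of "T y" x] by simp
qed

end

section \<open>The Einstein equation in an eigenframe of the torsion\<close>

context metric_lie_algebra
begin

lemma bianchi: "R x y z + R y z x + R z x y = 0"
proof -
  have D': "D a b = D b a + br a b" for a b using torsion_free[of a b] by (simp add: algebra_simps)
  have "R x y z + R y z x + R z x y =
      (D x (D y z - D z y) - D (br y z) x) + (D y (D z x - D x z) - D (br z x) y) + (D z (D x y - D y x) - D (br x y) z)"
    by (simp add: R_def D_simps)
  also have "\<dots> = br x (br y z) + br y (br z x) + br z (br x y)"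
    by (simp only: torsion_free)
  finally show ?thesis by (simp add: jacobi)
qed

lemma R_antisym: "R y x z = - R x y z"
  using br_swap[of x y] by (simp add: R_def D_simps)

lemma sum_D_skew:
  assumes "\<And>y. linear (\<lambda>x. \<beta> x y)" "\<And>x. linear (\<beta> x)"
  shows "(\<Sum>b\<in>B. \<beta> (D x b) b) = - (\<Sum>b\<in>B. \<beta> b (D x b) :: real)"
proof -
  have skew: "h (D x b) c = - h (D x c) b" for b c
    using D_skew[of x b c] h_sym[of b "D x c"] by simp
  have 1: "\<beta> (D x b) b = (\<Sum>c\<in>B. h (D x b) c * \<beta> c b)" for b
    using linear_expand[OF assms(1), of "D x b" b] by (simp only: real_scaleR_def)
  have 2: "\<beta> c (D x c) = (\<Sum>b\<in>B. h (D x c) b * \<beta> c b)" for c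
    using linear_expand[OF assms(2), of c "D x c"] by (simp only: real_scaleR_def)
  have "(\<Sum>b\<in>B. \<beta> (D x b) b) = (\<Sum>c\<in>B. \<Sum>b\<in>B. h (D x b) c * \<beta> c b)"
    unfolding 1 by (rule sum.swap)
  also have "\<dots> = (\<Sum>c\<in>B. \<Sum>b\<in>B. - (h (D x c) b * \<beta> c b))"
    by (intro sum.cong refl) (subst skew, simp)
  also have "\<dots> = - (\<Sum>c\<in>B. \<beta> c (D x c))"
    unfolding 2 by (simp only: sum_negf)
  finally show ?thesis .
qed

end

text \<open>From now on the frame diagonalises the torsion. The assumption \<open>trJ\<close> says that the
  connection has no component along \<open>J\<close>, that is, it does not rotate the phase of
  \<open>\<phi>\<close>.\<close>

locale su3_einstein = su3_torsion h J \<phi> u1 u2 u3 br T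
  for h :: "'a::real_vector \<Rightarrow> 'a \<Rightarrow> real" and J \<phi> u1 u2 u3 and br :: "'a \<Rightarrow> 'a \<Rightarrow> 'a" and T +
  fixes \<mu> s1 s2 s3 :: real
  assumes TJ: "T (J x) = J (T x)" and T_sym: "h (T x) y = h x (T y)"
    and trJ: "tr (\<lambda>y. J (D x y)) = 0"
    and eigen: "T u1 = s1 *\<^sub>R u1" "T u2 = s2 *\<^sub>R u2" "T u3 = s3 *\<^sub>R u3"
    and einstein: "Ric br h y z = \<mu> * h y z"
begin

text \<open>Up to a constant factor, this is the Ricci form on the plane of \<open>u1\<close>. The trace of
  $J [\nabla_x, \nabla_y]$ only sees the parts of $\nabla_x$ and $\nabla_y$ that do not commute
  with $J$, and these are given by the torsion.\<close>

lemma tr_J_R: "tr (\<lambda>b. J (R u1 (J u1) b)) = 2 * s1\<^sup>2"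
proof -
  have lin: "linear (\<lambda>z. J (D y z))" for y
    using linear_compose[OF D_linear(1) J_linear, of y] by (simp add: o_def)
  have "tr (\<lambda>b. J (R x y b)) = - tr (\<lambda>b. N x (D y b))" for x y
  proof -
    have "tr (\<lambda>b. J (R x y b)) = tr (\<lambda>b. J (D x (D y b))) - tr (\<lambda>b. J (D y (D x b)))"
      using trJ[of "br x y"] by (simp add: R_def J_simps tr_diff)
    also have "tr (\<lambda>b. J (D y (D x b))) = tr (\<lambda>b. D x (J (D y b)))"
      by (rule tr_comm[OF lin D_linear(1)])
    finally show ?thesis by (simp add: D_J tr_def sum.distrib)
  qed
  moreover have "tr (\<lambda>b. N u1 (D (J u1) b)) = - 2 * s1\<^sup>2"
    unfolding tr_def N_torsion sum_frame
    by (simp add: eigen \<phi>_simps \<phi>_J_front D_J JJ J_simps J_skew N_torsion TJ power2_eq_square)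
  ultimately show ?thesis by simp
qed

text \<open>The error made when \<open>J\<close> is moved past the curvature in the Ricci tensor.\<close>

definition E :: "'a \<Rightarrow> 'a \<Rightarrow> real" where
  "E x y = tr (\<lambda>b. R b x (J y) - J (R b x y))"

text \<open>The Bianchi identity expresses $\mathrm{tr}(J R(x, y))$ as the antisymmetric part of
  $\mathrm{tr}(b \mapsto J R(b, x) y)$, and \<open>E\<close> moves \<open>J\<close> past the
  curvature, so that the Einstein equation applies.\<close>

lemma ricci_form: "2 * \<mu> * h x (J y) = - tr (\<lambda>b. J (R x y b)) + E x y - E y x"
proof -
  have ric: "\<mu> * h x (J y) = tr (\<lambda>b. J (R b x y)) + E x y" for x y
    using einstein[of x "J y"] by (simp add: Ric_tr E_def tr_diff)
  have "J (R x y b) = J (R b y x) - J (R b x y)" for b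
  proof -
    have "R x y b = R b y x - R b x y"
    proof -
      have "R x y b - R b y x + R b x y = 0" using bianchi[of x y b] R_antisym[of b y x] by simp
      then show ?thesis by (simp add: algebra_simps)
    qed
    then show ?thesis by (simp add: J_simps)
  qed
  then have "tr (\<lambda>b. J (R x y b)) = tr (\<lambda>b. J (R b y x)) - tr (\<lambda>b. J (R b x y))" by (simp add: tr_diff)
  moreover have "h y (J x) = - h x (J y)" using J_skew[of x y] h_sym[of "J x" y] by simp
  ultimately show ?thesis using ric[of x y] ric[of y x] by simp
qed

text \<open>Differentiating $\nabla J$ produces derivatives of the torsion. Those which pair the symmetric
  \<open>T\<close> with the alternating \<open>\<phi>\<close> cancel in the sum over the frame.\<close>

lemma E_eq:
  "E x y = - (\<Sum>b\<in>frame. \<phi> (T x) y (D b b) + \<phi> (T x) (D b y) b + \<phi> (T (D b x)) y b)"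
proof -
  have diff: "R b x (J y) - J (R b x y)
      = N b (D x y) + D b (N x y) - N x (D b y) - D x (N b y) - N (br b x) y" for b
    by (simp add: R_def D_J D_simps J_simps)
  have summand: "h (R b x (J y) - J (R b x y)) b = \<phi> (T b) (D x y) b - \<phi> (T x) y (D b b) - \<phi> (T x) (D b y) b
      + \<phi> (T b) y (D x b) - \<phi> (T (D b x)) y b + \<phi> (T (D x b)) y b" for b
    unfolding diff torsion_free[of b x, symmetric]
    by (simp add: D_skew N_torsion T_simps \<phi>_simps)
  have "(\<Sum>b\<in>frame. \<phi> (T (D x b)) y b) = - (\<Sum>b\<in>frame. \<phi> (T b) y (D x b))"
    by (rule sum_D_skew) (auto intro!: linearI simp: T_simps \<phi>_simps)
  moreover have "(\<Sum>b\<in>frame. \<phi> (T b) (D x y) b) = 0"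
    unfolding sum_frame by (simp add: TJ eigen J_simps \<phi>_simps \<phi>_J_front JJ)
  ultimately show ?thesis
    unfolding E_def tr_def summand sum.distrib sum_subtractf by simp
qed

text \<open>Antisymmetrising on the complex line of \<open>u1\<close> removes what is left of the derivatives
  of the torsion: they commute with \<open>J\<close> up to the torsion itself. The result is an
  expression in the eigenvalues alone.\<close>

lemma E_antisymmetrized: "E u1 (J u1) - E (J u1) u1 = - (2 * s1 * s2 + 2 * s1 * s3 + 4 * s2 * s3)"
proof -
  let ?e = "\<lambda>x y b. \<phi> (T x) y (D b b) + \<phi> (T x) (D b y) b + \<phi> (T (D b x)) y b"
  have "?e u1 (J u1) b - ?e (J u1) u1 b = s1 * \<phi> u1 (N b u1) b - \<phi> (T (N b u1)) u1 b" for b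
    by (simp add: TJ eigen J_simps \<phi>_simps T_simps D_J \<phi>_J_front right_diff_distrib)
  then have "(\<Sum>b\<in>frame. ?e u1 (J u1) b) - (\<Sum>b\<in>frame. ?e (J u1) u1 b)
      = (\<Sum>b\<in>frame. s1 * \<phi> u1 (N b u1) b - \<phi> (T (N b u1)) u1 b)"
    by (simp only: sum_subtractf[symmetric])
  then have "E u1 (J u1) - E (J u1) u1 = - (\<Sum>b\<in>frame. s1 * \<phi> u1 (N b u1) b - \<phi> (T (N b u1)) u1 b)"
    unfolding E_eq by linarith
  also have "\<dots> = - (2 * s1 * s2 + 2 * s1 * s3 + 4 * s2 * s3)"
    unfolding sum_frame
    by (simp add: \<phi>_J_front T_sym eigen N_torsion TJ J_simps J_skew JJ \<phi>_simps algebra_simps)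
  finally show ?thesis .
qed

theorem einstein_constant: "\<mu> = s1\<^sup>2 + s1 * s2 + s1 * s3 + 2 * s2 * s3"
  using ricci_form[of u1 "J u1"] unfolding tr_J_R E_antisymmetrized[unfolded diff_conv_add_uminus]
  using E_antisymmetrized by (simp add: JJ)

end

text \<open>Subtracting the equations in pairs gives $(a-b)(a+b-c) = 0$ and its cyclic images. So two of the
  numbers agree, say $a = b$, and $c$ is $a$ or $0$; then $\mu$ is $5a^2$ or $2a^2$.\<close>

lemma einstein_system_nonneg:
  fixes \<mu> a b c :: real
  assumes "\<mu> = a\<^sup>2 + a * b + a * c + 2 * b * c" "\<mu> = b\<^sup>2 + b * c + b * a + 2 * c * a"
    "\<mu> = c\<^sup>2 + c * a + c * b + 2 * a * b"
  shows "\<mu> \<ge> 0"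
proof -
  have f: "(a - b) * (a + b - c) = 0" "(b - c) * (b + c - a) = 0" "(c - a) * (c + a - b) = 0"
    using assms by (simp_all add: algebra_simps power2_eq_square)
  have two: "\<mu> \<ge> 0" if "x = y" "x = z \<or> z = 0" "\<mu> = z\<^sup>2 + z * x + z * y + 2 * x * y" for x y z
    using that by auto
  show ?thesis
  proof (cases "a = b \<or> b = c \<or> c = a")
    case True
    then show ?thesis
      using f two[of a b c] two[of b c a] two[of c a b] assms by auto
  next
    case False
    then have "a + b = c" "b + c = a" "c + a = b" using f by auto
    then show ?thesis using False by linarith
  qed
qed

section \<open>Coupled Einstein structures\<close>

lemma ce_d_3: "ce_d br \<alpha> [x, y, z] = - \<alpha> [br x y, z] + \<alpha> [br x z, y] - \<alpha> [br y z, x]"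
  by (simp add: ce_d_def nths_Cons numeral_eq_Suc lessThan_Suc)

lemma ce_d_4: "ce_d br \<alpha> [x, y, z, w] = - \<alpha> [br x y, z, w] + \<alpha> [br x z, y, w] - \<alpha> [br y z, x, w]
    - \<alpha> [br x w, y, z] + \<alpha> [br y w, x, z] - \<alpha> [br z w, x, y]"
  by (simp add: ce_d_def nths_Cons numeral_eq_Suc lessThan_Suc)

text \<open>Dividing \<open>\<psi>\<close> by its modulus makes it a complex volume form, and the coupled
  equation turns the torsion into a Hermitian endomorphism. Diagonalising it and permuting the
  frame cyclically gives the three equations for the Einstein constant.\<close>

lemma coupled_einstein_nonneg:
  fixes br :: "'a::real_vector \<Rightarrow> 'a \<Rightarrow> 'a"
  assumes dim: "dim (UNIV :: 'a set) = 6" and lie: "lie_bracket br"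
    and SU3: "SU3_structure \<omega> \<psi>" and d\<omega>: "ce_d br \<omega> = (\<lambda>xs. c * \<psi> xs)" and d\<psi>: "ce_d br \<psi> = (\<lambda>_. 0)"
    and Einstein: "\<And>y z. Ric br (induced_metric \<omega> \<psi>) y z = \<mu> * induced_metric \<omega> \<psi> y z"
  shows "\<mu> \<ge> 0"
proof -
  define h J where "h = induced_metric \<omega> \<psi>" and "J = J_map \<omega> \<psi>"
  have Ein: "Ric br h y z = \<mu> * h y z" for y z using Einstein by (simp add: h_def)
  note J = SU3_structure_complex[OF dim SU3, folded h_def J_def]
  have \<psi>: "alt_form 3 \<psi>" and inner: "is_inner_product h" and st: "stable3 \<psi>"
    using SU3 by (auto simp: SU3_structure_def h_def)
  have lin: "linear (\<lambda>x. \<psi> [x, y, z])" for y z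
    using alt_form_linear[OF \<psi>, of "[0, y, z]" 0] by simp
  interpret complex_volume h J "\<lambda>x y z. \<psi> [x, y, z]"
    by (intro complex_volume.intro metric.intro complex_volume_axioms.intro)
      (rule inner J(1-3,5) lin alt3_swaps(1,2)[OF \<psi>])+
  have nz: "\<exists>x y z. \<psi> [x, y, z] \<noteq> 0"
  proof -
    obtain xs where xs: "\<psi> xs \<noteq> 0" using J(6) by blast
    then have "length xs = 3" using alt_form_length[OF \<psi>] by blast
    then show ?thesis using xs by (auto simp: length_Suc_conv numeral_eq_Suc)
  qed
  obtain r u1 u2 u3 where r: "r \<noteq> 0" and frame: "su3_frame h J (\<lambda>x y z. \<psi> [x, y, z] / r) u1 u2 u3"
    by (rule adapted_frame_exists[OF dim nz, of "\<lambda>x. x"]) (auto intro!: linearI)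
  define \<phi> where "\<phi> x y z = \<psi> [x, y, z] / r" for x y z
  interpret f: su3_frame h J \<phi> u1 u2 u3 using frame unfolding \<phi>_def .
  interpret metric_lie_algebra h "{u1, J u1, u2, J u2, u3, J u3}" br by unfold_locales (rule lie)
  interpret f: su3_lie_algebra h J \<phi> u1 u2 u3 br by unfold_locales
  obtain T where T: "linear T" "\<And>x y z. h (f.N x y) z = \<phi> (T x) y z" using f.torsion_exists by blast
  interpret f: su3_torsion h J \<phi> u1 u2 u3 br T
    by (intro su3_torsion.intro su3_torsion_axioms.intro f.su3_lie_algebra_axioms T)
  have flip: "h (J x) y = - h (J y) x" for x y using J_skew[of x y] h_sym[of x "J y"] by simp
  have N: "h (f.N x y) z = h (J (D x z)) y - h (J (D x y)) z" for x y z
    using flip[of y "D x z"] by (simp add: f.N_def D_skew)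
  have br_D: "br a b = D a b - D b a" for a b by (simp add: torsion_free)
  have commute: "T (J x) = J (T x)" for x
  proof (rule f.torsion_commutes[of "c * r"])
    fix x y z
    have "c * r * \<phi> x y z = c * \<psi> [x, y, z]" using r by (simp add: \<phi>_def)
    also have "\<dots> = - h (J (br x y)) z + h (J (br x z)) y - h (J (br y z)) x"
      using fun_cong[OF d\<omega>, of "[x, y, z]"] by (simp add: ce_d_3 J(4))
    also have "\<dots> = h (f.N x y) z + h (f.N y z) x + h (f.N z x) y"
      using N[of x y z] N[of y z x] N[of z x y] by (simp add: br_D J_simps)
    finally show "h (f.N x y) z + h (f.N y z) x + h (f.N z x) y = c * r * \<phi> x y z" by simp
  qed
  have closed: "su3_closed h J \<phi> u1 u2 u3 br T"
  proof (intro su3_closed.intro su3_closed_axioms.intro f.su3_torsion_axioms commute)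
    fix x y z w
    have "- \<phi> (br x y) z w + \<phi> (br x z) y w - \<phi> (br y z) x w
        - \<phi> (br x w) y z + \<phi> (br y w) x z - \<phi> (br z w) x y = 0"
      using fun_cong[OF d\<psi>, of "[x, y, z, w]"]
      by (simp add: ce_d_4 \<phi>_def flip: add_divide_distrib diff_divide_distrib minus_divide_left)
    then show "\<phi> (D x y) z w + \<phi> y (D x z) w + \<phi> y z (D x w)
      - (\<phi> (D y x) z w + \<phi> x (D y z) w + \<phi> x z (D y w))
      + (\<phi> (D z x) y w + \<phi> x (D z y) w + \<phi> x y (D z w))
      - (\<phi> (D w x) y z + \<phi> x (D w y) z + \<phi> x y (D w z)) = 0"
      using f.\<phi>_swap(1)[of y "D x z" w] f.\<phi>_swap(1)[of x "D y z" w] f.\<phi>_swap(1)[of x "D z y" w]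
        f.\<phi>_swap(1)[of x "D w y" z] f.\<phi>_rot[of "D x w" y z] f.\<phi>_rot[of "D y w" x z]
        f.\<phi>_rot[of "D z w" x y] f.\<phi>_rot[of "D w z" x y]
      by (simp add: br_D f.\<phi>_simps)
  qed
  interpret f: su3_closed h J \<phi> u1 u2 u3 br T by (rule closed)
  have nz\<phi>: "\<exists>x y z. \<phi> x y z \<noteq> 0" using f.\<phi>_frame(1) by (metis zero_neq_one)
  obtain k v1 v2 v3 s1 s2 s3 where k: "k \<noteq> 0" and vframe: "su3_frame h J (\<lambda>x y z. \<phi> x y z / k) v1 v2 v3"
    and v: "T v1 = s1 *\<^sub>R v1" "T v2 = s2 *\<^sub>R v2" "T v3 = s3 *\<^sub>R v3"
    by (rule f.adapted_frame_exists[OF dim nz\<phi> T(1) f.T_symmetric commute])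
  \<comment> \<open>Dividing \<open>\<phi>\<close> by \<open>k\<close> multiplies the torsion by \<open>k\<close>.\<close>
  have einstein: "su3_einstein h J (\<lambda>x y z. \<phi> x y z / k) w1 w2 w3 br (\<lambda>x. k *\<^sub>R T x) \<mu> (k * t1) (k * t2) (k * t3)"
    if "su3_frame h J (\<lambda>x y z. \<phi> x y z / k) w1 w2 w3"
      and w: "T w1 = t1 *\<^sub>R w1" "T w2 = t2 *\<^sub>R w2" "T w3 = t3 *\<^sub>R w3" for w1 w2 w3 t1 t2 t3
  proof -
    interpret w: su3_frame h J "\<lambda>x y z. \<phi> x y z / k" w1 w2 w3 by fact
    interpret wl: metric_lie_algebra h "{w1, J w1, w2, J w2, w3, J w3}" br by unfold_locales (rule lie)
    interpret wl: su3_lie_algebra h J "\<lambda>x y z. \<phi> x y z / k" w1 w2 w3 br by unfold_locales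
    have tors: "su3_torsion h J (\<lambda>x y z. \<phi> x y z / k) w1 w2 w3 br (\<lambda>x. k *\<^sub>R T x)"
    proof (intro su3_torsion.intro su3_torsion_axioms.intro wl.su3_lie_algebra_axioms)
      show "linear (\<lambda>x. k *\<^sub>R T x)" by (rule linear_compose_scale_right[OF T(1)])
      show "h (f.N x y) z = \<phi> (k *\<^sub>R T x) y z / k" for x y z
        using k T(2) by (simp add: f.\<phi>_simps)
    qed
    have "w.tr (\<lambda>y. J (D x y)) = 0" for x
      using f.trJ_eq_0[of x] linear_compose[OF D_linear(1) J_linear, of x]
      unfolding f.trJ_def by (subst w.tr_endo_trace[symmetric]) (simp_all add: o_def)
    then show ?thesis
      using Ein f.T_symmetric
      by (intro su3_einstein.intro su3_einstein_axioms.intro tors)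
        (simp_all add: commute w J_simps)
  qed
  show ?thesis
  proof (rule einstein_system_nonneg)
    show "\<mu> = (k * s1)\<^sup>2 + (k * s1) * (k * s2) + (k * s1) * (k * s3) + 2 * (k * s2) * (k * s3)"
      by (rule su3_einstein.einstein_constant[OF einstein[OF vframe v]])
    show "\<mu> = (k * s2)\<^sup>2 + (k * s2) * (k * s3) + (k * s2) * (k * s1) + 2 * (k * s3) * (k * s1)"
      by (rule su3_einstein.einstein_constant[OF einstein[OF su3_frame.rotate[OF vframe] v(2,3,1)]])
    show "\<mu> = (k * s3)\<^sup>2 + (k * s3) * (k * s1) + (k * s3) * (k * s2) + 2 * (k * s1) * (k * s2)"
      by (rule su3_einstein.einstein_constant[OF
            einstein[OF su3_frame.rotate[OF su3_frame.rotate[OF vframe]] v(3,1,2)]])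
  qed
qed

theorem corollary4p7:
  fixes br :: "'a::real_vector \<Rightarrow> 'a \<Rightarrow> 'a"
    and h :: "'a \<Rightarrow> 'a \<Rightarrow> real"
  assumes "dim (UNIV :: 'a set) = 6"
    and "lie_bracket br"
    and "solvable br"
    and "\<not> unimodular br"
    and "is_inner_product h"
    and "Einstein br h"
  shows "\<not> (\<exists>\<omega> \<psi>. coupled br \<omega> \<psi> \<and> induced_metric \<omega> \<psi> = h)"
proof
  assume "\<exists>\<omega> \<psi>. coupled br \<omega> \<psi> \<and> induced_metric \<omega> \<psi> = h"
  then obtain \<omega> \<psi> c where SU3: "SU3_structure \<omega> \<psi>" and d\<psi>: "ce_d br \<psi> = (\<lambda>_. 0)"
      and d\<omega>: "ce_d br \<omega> = (\<lambda>xs. c * \<psi> xs)" and h: "induced_metric \<omega> \<psi> = h"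
    by (auto simp: coupled_def half_flat_def)
  obtain \<mu> where \<mu>: "\<And>y z. Ric br h y z = \<mu> * h y z" using \<open>Einstein br h\<close> by (auto simp: Einstein_def)
  have "\<mu> \<ge> 0" using coupled_einstein_nonneg[OF assms(1,2) SU3 d\<omega> d\<psi>] \<mu> h by simp
  moreover have "\<mu> < 0"
  proof -
    interpret metric h by unfold_locales fact
    obtain B where "orthonormal h B" "span B = UNIV"
      using orthonormal_basis_exists[of 5] assms(1) by auto
    then interpret metric_lie_algebra h B br using assms(2) by unfold_locales
    show ?thesis using einstein_nonunimodular_negative[OF assms(4) \<mu>] .
  qed
  ultimately show False by simp
qed

end
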